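(* Let $r\geq 2$ be a fixed integer and let $p\in[0,1]$. For each integer $d\ge 1$ let $(\eta_t^{d,p})_{t\ge 0}$ be the threshold voter model on the torus $T^d(r)$ with initial distribution $\mu_p$, and let $A_t^{d,p}=\{x\in T^d(r):\eta_t^{d,p}(x)=1\}$. Then for any $T>0$: (i) if $p\in[0,1/2)$, then $$\lim_{d\rightarrow+\infty}\sup_{0\leq t\leq T}\Big|\frac{|A_t^{d,p}|}{r^d}-pe^{-t}\Big|=0\quad\text{in probability};$$ (ii) if $p\in(1/2,1]$, then $$\lim_{d\rightarrow+\infty}\sup_{0\leq t\leq T}\Big|\frac{|A_t^{d,p}|}{r^d}-1+(1-p)e^{-t}\Big|=0\quad\text{in probability}.$$
   Context: Torus: for integers $d\ge1$, $r\geq 2$, $T^d(r)$ is the $d$-dimensional torus with vertex set $\{1,2,\ldots,r\}^d$. For a vertex $x$ and $1\le i\le d$, $x^i$ is the vertex obtained from $x$ by replacing $x_i$ with $x_i+1$ if $x_i<r$ and with $1$ if $x_i=r$; for each $x$ and $i$ there is an edge connecting $x$ and $x^i$. Every vertex has degree $2d$; when $r=2$ the edges coming from $(x,i)$ and $(x^i,i)$ are two parallel edges. Write $y\sim x$ if $x$ and $y$ are neighbors; sums $\sum_{y:y\sim x}$ run over the $2d$ edges at $x$ (neighbors counted with edge multiplicity). Threshold voter model: the continuous-time, right-continuous Markov process $(\eta_t)_{t\ge0}$ with state space $\{0,1\}^{T^d(r)}$ in which the value at each vertex $x$ flips from $\eta(x)$ to $1-\eta(x)$ at rate $c(x,\eta)=1$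 if $\sum_{y:y\sim x}1_{\{\eta(y)\neq\eta(x)\}}\geq d$, and $c(x,\eta)=0$ otherwise. Equivalently, each vertex $x$ has an independent rate-$1$ Poisson process $N_x$, independent of the initial configuration, and at each event time $s$ of $N_x$ the value at $x$ flips if at least $d$ neighbors of $x$ have a value different from $\eta_{s-}(x)$, and stays unchanged otherwise. $\mu_p$ is the product measure on $\{0,1\}^{T^d(r)}$ with density $p$ (coordinates are i.i.d., equal to $1$ with probability $p$ and to $0$ with probability $1-p$). $\eta_t^{d,p}$ is the configuration at time $t$ of the threshold voter model on $T^d(r)$ when $\eta_0^{d,p}$ has distribution $\mu_p$. $|A|$ denotes cardinality. *)

theory Defs
  imports "HOL-Probability.Probability" "HOL-Probability.Product_PMF"
begin

type_synonym vertex = "nat \<Rightarrow> nat"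
type_synonym config = "vertex \<Rightarrow> nat"

section \<open>The torus\<close>

definition torus :: "nat \<Rightarrow> nat \<Rightarrow> vertex set" where
  "torus d r = {1..d} \<rightarrow>\<^sub>E {1..r}"

text \<open>\<open>shift r i x\<close> is the vertex \<open>x\<^sup>i\<close>.\<close>

definition shift :: "nat \<Rightarrow> nat \<Rightarrow> vertex \<Rightarrow> vertex" where
  "shift r i x = x(i := if x i < r then x i + 1 else 1)"

text \<open>
  An edge is a pair \<open>(z, i)\<close> with \<open>z\<close> a vertex and \<open>i\<close> a direction; it joins \<open>z\<close> to \<open>z\<^sup>i\<close>.
  The sum over the \<open>2d\<close> edges at \<open>x\<close> of the value of \<open>f\<close> at the other endpoint therefore splits
  into the edges \<open>(x, i)\<close> and the edges \<open>(z, i)\<close> with \<open>z\<^sup>i = x\<close>. For \<open>r = 2\<close> this counts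
  every neighbour twice, once for each of the two parallel edges.
\<close>

definition neighbour_sum :: "nat \<Rightarrow> nat \<Rightarrow> vertex \<Rightarrow> (vertex \<Rightarrow> nat) \<Rightarrow> nat" where
  "neighbour_sum d r x f =
     (\<Sum>i\<in>{1..d}. f (shift r i x)) +
     (\<Sum>(z, i)\<in>{(z, i). z \<in> torus d r \<and> i \<in> {1..d} \<and> shift r i z = x}. f z)"

section \<open>Continuous-time Markov processes of single-site flips\<close>

definition configs :: "vertex set \<Rightarrow> config set" where
  "configs V = V \<rightarrow>\<^sub>E {0, 1}"

definition flip :: "vertex \<Rightarrow> config \<Rightarrow> config" where
  "flip x \<xi> = \<xi>(x := 1 - \<xi> x)"

text \<open>
  For a finite vertex set \<open>V\<close> and flip rates \<open>c x \<xi>\<close>, the generator is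
  \<open>(L f) \<xi> = (\<Sum>x\<in>V. c x \<xi> * (f (flip x \<xi>) - f \<xi>))\<close>. It is a bounded operator, and the
  transition probability from \<open>\<xi>\<close> to \<open>\<zeta>\<close> in time \<open>t\<close> is \<open>exp (t L)\<close> applied to the
  indicator of \<open>\<zeta>\<close>, evaluated at \<open>\<xi>\<close>.
\<close>

definition flip_generator ::
  "vertex set \<Rightarrow> (vertex \<Rightarrow> config \<Rightarrow> real) \<Rightarrow> (config \<Rightarrow> real) \<Rightarrow> config \<Rightarrow> real" where
  "flip_generator V c f \<xi> = (\<Sum>x\<in>V. c x \<xi> * (f (flip x \<xi>) - f \<xi>))"

definition flip_semigroup ::
  "vertex set \<Rightarrow> (vertex \<Rightarrow> config \<Rightarrow> real) \<Rightarrow> real \<Rightarrow> (config \<Rightarrow> real) \<Rightarrow> config \<Rightarrow> real" where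
  "flip_semigroup V c t f \<xi> = (\<Sum>n. t ^ n / fact n * ((flip_generator V c ^^ n) f) \<xi>)"

definition transition_prob ::
  "vertex set \<Rightarrow> (vertex \<Rightarrow> config \<Rightarrow> real) \<Rightarrow> real \<Rightarrow> config \<Rightarrow> config \<Rightarrow> real" where
  "transition_prob V c t \<xi> \<zeta> = flip_semigroup V c t (indicator {\<zeta>}) \<xi>"

text \<open>
  Right-continuity is with respect to the discrete topology on the finite state space. The last
  clause is the Markov property, given through the finite-dimensional distributions.
\<close>

definition flip_process ::
  "vertex set \<Rightarrow> (vertex \<Rightarrow> config \<Rightarrow> real) \<Rightarrow> 'w measure \<Rightarrow> (real \<Rightarrow> 'w \<Rightarrow> config) \<Rightarrow> bool" where
  "flip_process V c M \<eta> \<longleftrightarrow>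
     prob_space M \<and>
     (\<forall>t\<ge>0. \<eta> t \<in> measurable M (count_space (configs V))) \<and>
     (\<forall>\<omega>\<in>space M. \<forall>t\<ge>0. \<forall>\<^sub>F s in at_right t. \<eta> s \<omega> = \<eta> t \<omega>) \<and>
     (\<forall>(n::nat) (t :: nat \<Rightarrow> real) (\<xi> :: nat \<Rightarrow> config).
        t 0 = 0 \<longrightarrow> (\<forall>k<n. t k \<le> t (Suc k)) \<longrightarrow> (\<forall>k\<le>n. \<xi> k \<in> configs V) \<longrightarrow>
        measure M {\<omega>\<in>space M. \<forall>k\<le>n. \<eta> (t k) \<omega> = \<xi> k} =
          measure M {\<omega>\<in>space M. \<eta> 0 \<omega> = \<xi> 0} *
          (\<Prod>k<n. transition_prob V c (t (Suc k) - t k) (\<xi> k) (\<xi> (Suc k))))"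

section \<open>The threshold voter model\<close>

definition threshold_rate :: "nat \<Rightarrow> nat \<Rightarrow> vertex \<Rightarrow> config \<Rightarrow> real" where
  "threshold_rate d r x \<xi> =
     (if neighbour_sum d r x (\<lambda>y. if \<xi> y \<noteq> \<xi> x then 1 else 0) \<ge> d then 1 else 0)"

definition product_law :: "vertex set \<Rightarrow> real \<Rightarrow> config pmf" where
  "product_law V p = Pi_pmf V undefined (\<lambda>_. map_pmf of_bool (bernoulli_pmf p))"

definition threshold_voter_model ::
  "nat \<Rightarrow> nat \<Rightarrow> real \<Rightarrow> 'w measure \<Rightarrow> (real \<Rightarrow> 'w \<Rightarrow> config) \<Rightarrow> bool" where
  "threshold_voter_model d r p M \<eta> \<longleftrightarrow>
     flip_process (torus d r) (threshold_rate d r) M \<eta> \<and>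
     distr M (count_space UNIV) (\<eta> 0) = measure_pmf (product_law (torus d r) p)"

definition ones :: "nat \<Rightarrow> nat \<Rightarrow> config \<Rightarrow> vertex set" where
  "ones d r \<xi> = {x \<in> torus d r. \<xi> x = 1}"

section \<open>Convergence in probability\<close>

text \<open>
  The \<open>n\<close>-th variable lives on its own probability space \<open>M n\<close>. Measurability is demanded since
  \<open>measure\<close> is \<open>0\<close> on non-measurable sets.
\<close>

definition tendsto_in_prob ::
  "(nat \<Rightarrow> 'w measure) \<Rightarrow> (nat \<Rightarrow> 'w \<Rightarrow> real) \<Rightarrow> real \<Rightarrow> bool" where
  "tendsto_in_prob M X l \<longleftrightarrow>
     (\<forall>\<^sub>F n in sequentially. X n \<in> borel_measurable (M n)) \<and>
     (\<forall>\<epsilon>>0. (\<lambda>n. measure (M n) {\<omega> \<in> space (M n). \<bar>X n \<omega> - l\<bar> > \<epsilon>}) \<longlonglongrightarrow> 0)"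

end

theory Submission
  imports Defs
begin

text \<open>
  Let \<open>p < 1/2\<close>. A vertex has \<open>2d\<close> edges, so for large \<open>d\<close> the law of large numbers
  shows that initially almost every vertex sees a fraction of about \<open>p\<close> ones around it, in
  particular fewer than \<open>d\<close> ones. Such a vertex turns to 0 at rate 1 if it is a 1, and stays put
  if it is a 0. If this remains true up to time \<open>T\<close>, the density of ones decays like
  \<open>p * exp (- t)\<close>.

  The point is that the exceptional vertices, called crowded below, cannot trigger an avalanche.
  Their fraction is dominated by the average \<open>\<Phi>\<close> of a piecewise linear function of the fraction
  of ones around a vertex (\<open>excess\<close>). New ones appear at crowded vertices only, and each of them
  changes this function at its \<open>2d\<close> neighbours by \<open>O(1/d)\<close>. So the generator satisfies
  \<open>L \<Phi> \<le> K \<Phi>\<close> with \<open>K = 1 / (1/2 - p)\<close>, uniformly in \<open>d\<close>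
  (\<open>excess_drift\<close> with \<open>crowded_le_excess\<close>), while the initial expectation of
  \<open>\<Phi>\<close> is \<open>O(1 / sqrt d)\<close> (\<open>expected_excess\<close>).

  Let \<open>X\<close> be the density of ones. Since \<open>\<bar>L X + X\<bar>\<close> is at most the
  fraction of crowded vertices (\<open>ones_density_drift\<close>), hence at most \<open>\<Phi>\<close>, and
  the sum of the squared jumps of \<open>X\<close> is of order \<open>1 / r ^ d\<close>, the function \<open>(exp t * X - p)\<^sup>2\<close> becomes a supermartingale after
  adding a decreasing multiple of \<open>\<Phi>\<close> and a deterministic term (\<open>potential_drift\<close>). The
  maximal inequality for nonnegative supermartingales (\<open>discrete_maximal_inequality\<close>, extended to
  continuous time in \<open>maximal_inequality\<close>) then bounds the probability that the supremum of the
  deviation exceeds \<open>\<epsilon>\<close> by the initial expectation divided by \<open>\<epsilon>\<^sup>2\<close>, which is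
  \<open>O(1 / sqrt d)\<close> (\<open>deviation_bound\<close>).

  The rates are invariant under the exchange of zeros and ones, and this exchange turns \<open>p > 1/2\<close>
  into \<open>1 - p < 1/2\<close>.
\<close>

section \<open>The semigroup of a finite flip process\<close>

lemma finite_configs: "finite V \<Longrightarrow> finite (configs V)"
  unfolding configs_def by (intro finite_PiE) auto

lemma flip_in_configs: "x \<in> V \<Longrightarrow> \<xi> \<in> configs V \<Longrightarrow> flip x \<xi> \<in> configs V"
  unfolding configs_def flip_def by (auto simp: PiE_iff extensional_def)

lemma flip_generator_sum:
  "flip_generator V c (\<lambda>\<xi>. \<Sum>i\<in>I. a i * f i \<xi>) \<xi> = (\<Sum>i\<in>I. a i * flip_generator V c (f i) \<xi>)"
proof -
  have "flip_generator V c (\<lambda>\<xi>. \<Sum>i\<in>I. a i * f i \<xi>) \<xi>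
      = (\<Sum>x\<in>V. \<Sum>i\<in>I. a i * (c x \<xi> * (f i (flip x \<xi>) - f i \<xi>)))"
    unfolding flip_generator_def
    by (simp add: sum_subtractf [symmetric] sum_distrib_left algebra_simps)
  also have "\<dots> = (\<Sum>i\<in>I. a i * flip_generator V c (f i) \<xi>)"
    unfolding flip_generator_def by (subst sum.swap) (simp add: sum_distrib_left)
  finally show ?thesis .
qed

lemma flip_generator_cong:
  assumes "\<And>\<zeta>. \<zeta> \<in> configs V \<Longrightarrow> f \<zeta> = g \<zeta>" and "\<xi> \<in> configs V"
  shows "flip_generator V c f \<xi> = flip_generator V c g \<xi>"
  unfolding flip_generator_def using assms by (intro sum.cong) (auto simp: flip_in_configs)

lemma flip_generator_power_add_smult:
  "(flip_generator V c ^^ n) (\<lambda>\<xi>. f \<xi> + a * g \<xi>)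
    = (\<lambda>\<xi>. (flip_generator V c ^^ n) f \<xi> + a * (flip_generator V c ^^ n) g \<xi>)"
proof (induction n arbitrary: f g)
  case (Suc n)
  have "flip_generator V c (\<lambda>\<xi>. f \<xi> + a * g \<xi>)
      = (\<lambda>\<xi>. flip_generator V c f \<xi> + a * flip_generator V c g \<xi>)" for f g
    unfolding flip_generator_def
    by (rule ext) (simp add: sum_distrib_left sum.distrib [symmetric] algebra_simps)
  then show ?case
    using Suc by (simp add: funpow_swap1)
qed simp

lemma indicator_expansion:
  fixes f :: "config \<Rightarrow> real"
  assumes "finite V" "\<xi> \<in> configs V"
  shows "(\<Sum>\<zeta>\<in>configs V. f \<zeta> * indicator {\<zeta>} \<xi>) = f \<xi>"
proof -
  have "(\<Sum>\<zeta>\<in>configs V. f \<zeta> * indicator {\<zeta>} \<xi>) = (\<Sum>\<zeta>\<in>configs V. if \<xi> = \<zeta> then f \<zeta> else 0)"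
    by (intro sum.cong) (auto simp: indicator_def)
  then show ?thesis
    using assms by (simp add: finite_configs)
qed

text \<open>
  The power series of the semigroup is defined for every function on configurations. On the finite
  set \<open>configs V\<close>, which the dynamics does not leave, linearity reduces it to a matrix acting
  on vectors, whose entries are the transition probabilities.
\<close>

lemma flip_generator_power_expansion:
  assumes "finite V" and "\<xi> \<in> configs V"
  shows "(flip_generator V c ^^ n) f \<xi>
    = (\<Sum>\<zeta>\<in>configs V. f \<zeta> * (flip_generator V c ^^ n) (indicator {\<zeta>}) \<xi>)"
  using assms(2)
proof (induction n arbitrary: \<xi>)
  case 0
  then show ?case by (simp add: indicator_expansion assms(1))
next
  case (Suc n)
  have "flip_generator V c ((flip_generator V c ^^ n) f) \<xi>
     = flip_generator V c (\<lambda>\<xi>. \<Sum>\<zeta>\<in>configs V. f \<zeta> * (flip_generator V c ^^ n) (indicator {\<zeta>}) \<xi>) \<xi>"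
    using Suc by (intro flip_generator_cong) auto
  then show ?case by (simp add: flip_generator_sum)
qed

text \<open>
  Rates in \<open>[0, 1]\<close> make the generator a bounded operator, so that the exponential series
  converges absolutely and can be differentiated term by term.
\<close>

locale flip_rates =
  fixes V :: "vertex set" and c :: "vertex \<Rightarrow> config \<Rightarrow> real"
  assumes finite_sites: "finite V"
    and rate_nonneg: "0 \<le> c x \<xi>"
    and rate_le_1: "c x \<xi> \<le> 1"
begin

lemma flip_generator_power_bound:
  assumes "\<And>\<zeta>. \<zeta> \<in> configs V \<Longrightarrow> \<bar>f \<zeta>\<bar> \<le> B" and "\<xi> \<in> configs V"
  shows "\<bar>(flip_generator V c ^^ n) f \<xi>\<bar> \<le> (2 * real (card V)) ^ n * B"
  using assms(2)
proof (induction n arbitrary: \<xi>)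
  case 0
  then show ?case using assms(1) by simp
next
  case (Suc n)
  let ?g = "(flip_generator V c ^^ n) f" and ?b = "(2 * real (card V)) ^ n * B"
  have "\<bar>c x \<xi> * (?g (flip x \<xi>) - ?g \<xi>)\<bar> \<le> 2 * ?b" if "x \<in> V" for x
  proof -
    have "\<bar>?g (flip x \<xi>)\<bar> \<le> ?b" "\<bar>?g \<xi>\<bar> \<le> ?b"
      using Suc that by (auto intro!: Suc.IH flip_in_configs)
    then have "\<bar>?g (flip x \<xi>) - ?g \<xi>\<bar> \<le> 2 * ?b" by linarith
    then have "\<bar>c x \<xi>\<bar> * \<bar>?g (flip x \<xi>) - ?g \<xi>\<bar> \<le> 1 * (2 * ?b)"
      using rate_nonneg rate_le_1 by (intro mult_mono) auto
    then show ?thesis by (simp add: abs_mult)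
  qed
  then have "\<bar>flip_generator V c ?g \<xi>\<bar> \<le> (\<Sum>x\<in>V. 2 * ?b)"
    unfolding flip_generator_def by (intro order_trans [OF sum_abs] sum_mono)
  then show ?case by (simp add: algebra_simps)
qed

lemma summable_flip_semigroup:
  assumes "\<xi> \<in> configs V"
  shows "summable (\<lambda>n. \<bar>t ^ n / fact n * (flip_generator V c ^^ n) f \<xi>\<bar>)"
proof -
  define B where "B = (\<Sum>\<zeta>\<in>configs V. \<bar>f \<zeta>\<bar>)"
  have B: "\<bar>f \<zeta>\<bar> \<le> B" if "\<zeta> \<in> configs V" for \<zeta>
    unfolding B_def using that finite_configs [OF finite_sites]
    by (intro member_le_sum) auto
  have "summable (\<lambda>n. B * (inverse (fact n) * (\<bar>t\<bar> * (2 * real (card V))) ^ n))"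
    by (intro summable_mult summable_exp)
  moreover have "norm \<bar>t ^ n / fact n * (flip_generator V c ^^ n) f \<xi>\<bar>
      \<le> B * (inverse (fact n) * (\<bar>t\<bar> * (2 * real (card V))) ^ n)" for n
  proof -
    have "\<bar>t ^ n / fact n\<bar> * \<bar>(flip_generator V c ^^ n) f \<xi>\<bar>
        \<le> \<bar>t ^ n / fact n\<bar> * ((2 * real (card V)) ^ n * B)"
      by (intro mult_left_mono flip_generator_power_bound B assms) auto
    then show ?thesis
      by (simp add: abs_mult power_abs power_mult_distrib field_simps)
  qed
  ultimately show ?thesis by (rule summable_comparison_test' [where N = 0])
qed

lemmas summable_flip_semigroup' = summable_rabs_cancel [OF summable_flip_semigroup]

lemma flip_semigroup_expansion:
  assumes "\<xi> \<in> configs V"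
  shows "flip_semigroup V c t f \<xi> = (\<Sum>\<zeta>\<in>configs V. f \<zeta> * transition_prob V c t \<xi> \<zeta>)"
proof -
  have "flip_semigroup V c t f \<xi> = (\<Sum>n. \<Sum>\<zeta>\<in>configs V.
      f \<zeta> * (t ^ n / fact n * (flip_generator V c ^^ n) (indicator {\<zeta>}) \<xi>))"
    unfolding flip_semigroup_def
    by (subst flip_generator_power_expansion [OF finite_sites assms, where f = f])
       (simp add: sum_distrib_left algebra_simps)
  also have "\<dots> = (\<Sum>\<zeta>\<in>configs V. \<Sum>n.
      f \<zeta> * (t ^ n / fact n * (flip_generator V c ^^ n) (indicator {\<zeta>}) \<xi>))"
    by (intro suminf_sum summable_mult summable_flip_semigroup' assms)
  also have "\<dots> = (\<Sum>\<zeta>\<in>configs V. f \<zeta> * transition_prob V c t \<xi> \<zeta>)"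
    unfolding transition_prob_def flip_semigroup_def
    by (intro sum.cong refl suminf_mult summable_flip_semigroup' assms)
  finally show ?thesis .
qed

lemma flip_semigroup_has_derivative:
  assumes "\<xi> \<in> configs V"
  shows "((\<lambda>t. flip_semigroup V c t f \<xi>) has_real_derivative
           flip_semigroup V c t (flip_generator V c f) \<xi>) (at t)"
proof -
  let ?a = "\<lambda>n. (flip_generator V c ^^ n) f \<xi> / fact n"
  have *: "(\<lambda>n. ?a n * t ^ n) = (\<lambda>n. t ^ n / fact n * (flip_generator V c ^^ n) f \<xi>)" for t
    by (auto simp: fun_eq_iff field_simps)
  have "summable (\<lambda>n. ?a n * t ^ n)" for t
    unfolding * by (rule summable_flip_semigroup' [OF assms])
  then have "((\<lambda>t. \<Sum>n. ?a n * t ^ n) has_real_derivative (\<Sum>n. diffs ?a n * t ^ n)) (at t)"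
    by (rule termdiffs_strong_converges_everywhere)
  moreover have "diffs ?a n * t ^ n
      = t ^ n / fact n * (flip_generator V c ^^ n) (flip_generator V c f) \<xi>" for n
    unfolding diffs_def fact_Suc by (simp add: funpow_swap1 del: of_nat_Suc)
  ultimately show ?thesis
    unfolding flip_semigroup_def * by simp
qed

text \<open>
  This is \<open>card V\<close> times the transition operator of the uniformized discrete-time chain: pick a
  site uniformly, then flip it with probability equal to its rate. It maps nonnegative functions to
  nonnegative functions, which the generator does not do.
\<close>

definition jump_operator :: "(config \<Rightarrow> real) \<Rightarrow> config \<Rightarrow> real" where
  "jump_operator f \<xi> = flip_generator V c f \<xi> + real (card V) * f \<xi>"

lemma jump_operator_power_nonneg:
  assumes "\<And>\<zeta>. \<zeta> \<in> configs V \<Longrightarrow> 0 \<le> f \<zeta>" and "\<xi> \<in> configs V"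
  shows "0 \<le> (jump_operator ^^ n) f \<xi>"
  using assms(2)
proof (induction n arbitrary: \<xi>)
  case 0
  then show ?case using assms(1) by simp
next
  case (Suc n)
  have "jump_operator g \<xi> = (\<Sum>x\<in>V. c x \<xi> * g (flip x \<xi>) + (1 - c x \<xi>) * g \<xi>)" for g
    unfolding jump_operator_def flip_generator_def
    by (simp add: sum.distrib sum_subtractf algebra_simps)
  then show ?case
    using Suc rate_nonneg rate_le_1
    by (auto intro!: sum_nonneg add_nonneg_nonneg mult_nonneg_nonneg Suc.IH flip_in_configs)
qed

text \<open>
  The jump operator is the generator plus a multiple of the identity, and these two commute,
  so the binomial theorem applies.
\<close>

lemma jump_operator_power_binomial:
  "(jump_operator ^^ n) f \<xi>
    = (\<Sum>k\<le>n. real (n choose k) * real (card V) ^ k * (flip_generator V c ^^ (n - k)) f \<xi>)"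
proof (induction n arbitrary: f)
  case (Suc n)
  let ?u = "\<lambda>k. (flip_generator V c ^^ k) f \<xi>"
  have step: "(flip_generator V c ^^ m) (jump_operator f) \<xi> = ?u (Suc m) + real (card V) * ?u m" for m
  proof -
    have "jump_operator f = (\<lambda>\<xi>. flip_generator V c f \<xi> + real (card V) * f \<xi>)"
      by (auto simp: jump_operator_def)
    then show ?thesis
      by (simp add: flip_generator_power_add_smult funpow_swap1)
  qed
  have "(jump_operator ^^ Suc n) f \<xi>
      = (\<Sum>k\<le>n. real (n choose k) * real (card V) ^ k * (?u (Suc (n - k)) + real (card V) * ?u (n - k)))"
    by (simp only: funpow_Suc_right o_def Suc.IH step)
  also have "\<dots> = (\<Sum>k\<le>n. real (n choose k) * real (card V) ^ k * ?u (Suc n - k))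
      + (\<Sum>k\<le>n. real (n choose k) * real (card V) ^ Suc k * ?u (n - k))"
    by (simp add: sum.distrib [symmetric] Suc_diff_le algebra_simps)
  also have "(\<Sum>k\<le>n. real (n choose k) * real (card V) ^ k * ?u (Suc n - k))
      = (\<Sum>k\<le>Suc n. real (n choose k) * real (card V) ^ k * ?u (Suc n - k))"
    by simp
  also have "\<dots> = ?u (Suc n) + (\<Sum>k\<le>n. real (n choose Suc k) * real (card V) ^ Suc k * ?u (n - k))"
    by (subst sum.atMost_Suc_shift) simp
  finally show ?case
    by (subst sum.atMost_Suc_shift) (simp add: sum.distrib [symmetric] algebra_simps)
qed simp

text \<open>
  Multiplying the series of \<open>exp (t L)\<close> by the series of \<open>exp (t * card V)\<close> gives the
  exponential series of the jump operator, all of whose terms are nonnegative.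
\<close>

lemma transition_prob_nonneg:
  assumes "0 \<le> t" and "\<xi> \<in> configs V"
  shows "0 \<le> transition_prob V c t \<xi> \<zeta>"
proof -
  let ?f = "indicator {\<zeta>} :: config \<Rightarrow> real"
  let ?a = "\<lambda>n. (t * real (card V)) ^ n /\<^sub>R fact n" 
  let ?b = "\<lambda>n. t ^ n / fact n * (flip_generator V c ^^ n) ?f \<xi>"
  have "summable (\<lambda>k. norm (?a k))"
    by (rule summable_norm_exp)
  moreover have "summable (\<lambda>k. norm (?b k))"
    using summable_flip_semigroup [OF assms(2)] by simp
  ultimately have "(\<lambda>n. \<Sum>k\<le>n. ?a k * ?b (n - k)) sums ((\<Sum>k. ?a k) * (\<Sum>k. ?b k))"
    by (rule Cauchy_product_sums)
  moreover have "(\<Sum>k\<le>n. ?a k * ?b (n - k)) = t ^ n / fact n * (jump_operator ^^ n) ?f \<xi>" for n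
  proof -
    have "?a k * ?b (n - k) = t ^ n / fact n *
        (real (n choose k) * real (card V) ^ k * (flip_generator V c ^^ (n - k)) ?f \<xi>)" if "k \<le> n" for k
    proof -
      have "t ^ n = t ^ k * t ^ (n - k)" using that by (simp flip: power_add)
      then show ?thesis
        using that by (simp add: binomial_fact power_mult_distrib field_simps)
    qed
    then show ?thesis
      unfolding jump_operator_power_binomial sum_distrib_left by (intro sum.cong) auto
  qed
  ultimately have series: "(\<lambda>n. t ^ n / fact n * (jump_operator ^^ n) ?f \<xi>) sums
      (exp (t * real (card V)) * transition_prob V c t \<xi> \<zeta>)"
    unfolding transition_prob_def flip_semigroup_def exp_def by simp
  have "0 \<le> t ^ n / fact n * (jump_operator ^^ n) ?f \<xi>" for n
    using assms by (intro mult_nonneg_nonneg jump_operator_power_nonneg) auto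
  from sums_le [OF this sums_zero series]
  have "0 \<le> exp (t * real (card V)) * transition_prob V c t \<xi> \<zeta>" .
  then show ?thesis
    by (simp add: zero_le_mult_iff)
qed

lemma transition_prob_0: "transition_prob V c 0 \<xi> \<zeta> = indicator {\<zeta>} \<xi>"
proof -
  have "(\<lambda>n. 0 ^ n / fact n * (flip_generator V c ^^ n) f \<xi>) sums f \<xi>" for f
    using powser_sums_zero [of "\<lambda>n. (flip_generator V c ^^ n) f \<xi> / fact n"]
    by (simp add: field_simps)
  then show ?thesis
    unfolding transition_prob_def flip_semigroup_def by (rule sums_unique [symmetric])
qed

text \<open>
  If the space-time function \<open>G\<close> satisfies \<open>(d/dt + L) G \<le> 0\<close>, then the expectation
  of \<open>G v\<close> at time \<open>v\<close>, started at \<open>\<xi>\<close> at time \<open>s\<close>, is nonincreasing in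
  \<open>v\<close>: by Kolmogorov's forward equation its derivative is the expectation of
  \<open>(d/dv + L) G\<close>, and transition probabilities are nonnegative.
\<close>

lemma transition_prob_superharmonic:
  fixes G G' :: "real \<Rightarrow> config \<Rightarrow> real"
  assumes "s \<le> u" and \<xi>: "\<xi> \<in> configs V"
    and deriv: "\<And>v \<zeta>. s \<le> v \<Longrightarrow> v \<le> u \<Longrightarrow> \<zeta> \<in> configs V \<Longrightarrow>
      ((\<lambda>v. G v \<zeta>) has_real_derivative G' v \<zeta>) (at v)"
    and le: "\<And>v \<zeta>. s \<le> v \<Longrightarrow> v \<le> u \<Longrightarrow> \<zeta> \<in> configs V \<Longrightarrow>
      G' v \<zeta> + flip_generator V c (G v) \<zeta> \<le> 0"
  shows "(\<Sum>\<zeta>\<in>configs V. transition_prob V c (u - s) \<xi> \<zeta> * G u \<zeta>) \<le> G s \<xi>"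
proof -
  let ?P = "\<lambda>v \<zeta>. transition_prob V c (v - s) \<xi> \<zeta>"
  let ?P' = "\<lambda>v \<zeta>. flip_semigroup V c (v - s) (flip_generator V c (indicator {\<zeta>})) \<xi>"
  define h where "h v = (\<Sum>\<zeta>\<in>configs V. G v \<zeta> * ?P v \<zeta>)" for v
  have P': "((\<lambda>v. ?P v \<zeta>) has_real_derivative ?P' v \<zeta>) (at v)" for v \<zeta>
  proof -
    have "((\<lambda>v. v - s) has_real_derivative 1) (at v)"
      by (auto intro!: derivative_eq_intros)
    from DERIV_chain2 [where g = "\<lambda>v. v - s" and x = v, OF flip_semigroup_has_derivative [OF \<xi>] this]
    show ?thesis by (simp add: transition_prob_def)
  qed
  \<comment> \<open>The derivative of the semigroup applied to f, computed in two ways: termwise in the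
    expansion of f into indicators, and as the semigroup applied to L f.\<close>
  have kolmogorov: "(\<Sum>\<zeta>\<in>configs V. f \<zeta> * ?P' v \<zeta>)
      = (\<Sum>\<zeta>\<in>configs V. flip_generator V c f \<zeta> * ?P v \<zeta>)" for f v
  proof -
    have "((\<lambda>v. \<Sum>\<zeta>\<in>configs V. f \<zeta> * transition_prob V c v \<xi> \<zeta>) has_real_derivative
        (\<Sum>\<zeta>\<in>configs V. f \<zeta> * ?P' v \<zeta>)) (at (v - s))"
      unfolding transition_prob_def
      by (intro DERIV_sum DERIV_cmult flip_semigroup_has_derivative \<xi>)
    moreover have "((\<lambda>v. \<Sum>\<zeta>\<in>configs V. f \<zeta> * transition_prob V c v \<xi> \<zeta>) has_real_derivative
        flip_semigroup V c (v - s) (flip_generator V c f) \<xi>) (at (v - s))"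
      using flip_semigroup_has_derivative [OF \<xi>, of f] by (simp add: flip_semigroup_expansion [OF \<xi>])
    ultimately have "(\<Sum>\<zeta>\<in>configs V. f \<zeta> * ?P' v \<zeta>)
        = flip_semigroup V c (v - s) (flip_generator V c f) \<xi>"
      by (rule DERIV_unique)
    then show ?thesis
      by (simp add: flip_semigroup_expansion [OF \<xi>])
  qed
  have "h u \<le> h s"
  proof (rule DERIV_nonpos_imp_nonincreasing [OF \<open>s \<le> u\<close>])
    fix v assume v: "s \<le> v" "v \<le> u"
    have "(h has_real_derivative (\<Sum>\<zeta>\<in>configs V. G' v \<zeta> * ?P v \<zeta> + ?P' v \<zeta> * G v \<zeta>)) (at v)"
      unfolding h_def by (intro DERIV_sum DERIV_mult deriv P' v)
    moreover have "(\<Sum>\<zeta>\<in>configs V. G' v \<zeta> * ?P v \<zeta> + ?P' v \<zeta> * G v \<zeta>)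
        = (\<Sum>\<zeta>\<in>configs V. ?P v \<zeta> * (G' v \<zeta> + flip_generator V c (G v) \<zeta>))"
      using kolmogorov [of "G v" v] by (simp add: sum.distrib algebra_simps)
    moreover have "\<dots> \<le> 0"
      using v le transition_prob_nonneg [OF _ \<xi>] by (intro sum_nonpos mult_nonneg_nonpos) auto
    ultimately show "\<exists>y. (h has_real_derivative y) (at v) \<and> y \<le> 0" by auto
  qed
  moreover have "h s = G s \<xi>"
    unfolding h_def by (simp add: transition_prob_0 indicator_expansion finite_sites \<xi>)
  ultimately show ?thesis by (simp add: h_def mult.commute)
qed

end

section \<open>Supermartingales along a flip process\<close>

locale flip_system = flip_rates +
  fixes M :: "'w measure" and \<eta> :: "real \<Rightarrow> 'w \<Rightarrow> config"
  assumes process: "flip_process V c M \<eta>"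
begin

sublocale prob_space M
  using process by (simp add: flip_process_def)

lemma state_in_configs: "0 \<le> t \<Longrightarrow> \<omega> \<in> space M \<Longrightarrow> \<eta> t \<omega> \<in> configs V"
  using process measurable_space [of "\<eta> t" M "count_space (configs V)" \<omega>]
  by (auto simp: flip_process_def)

lemma measurable_state: 
  assumes "0 \<le> t"
  shows "\<eta> t \<in> measurable M (count_space UNIV)"
proof -
  have "\<eta> t \<in> measurable M (count_space (configs V))"
    using process assms by (simp add: flip_process_def)
  then show ?thesis
    by (rule measurable_compose) simp
qed

lemma state_event: "0 \<le> t \<Longrightarrow> {\<omega> \<in> space M. P (\<eta> t \<omega>)} \<in> events"
  using measurable_sets [OF measurable_state, of t "{\<xi>. P \<xi>}"]
  by (simp add: vimage_def Int_def conj_commute)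

lemma all_states_event:
  fixes t :: "nat \<Rightarrow> real"
  assumes "\<And>j. 0 \<le> t j"
  shows "{\<omega> \<in> space M. \<forall>j. Q j \<longrightarrow> P j (\<eta> (t j) \<omega>)} \<in> events"
  using state_event [OF assms] by (intro sets.sets_Collect_countable_All) auto

lemma some_state_event:
  fixes t :: "nat \<Rightarrow> real"
  assumes "\<And>j. 0 \<le> t j"
  shows "{\<omega> \<in> space M. \<exists>j. Q j \<and> P j (\<eta> (t j) \<omega>)} \<in> events"
  using state_event [OF assms] by (intro sets.sets_Collect_countable_Ex) auto

text \<open>
  The process is given through probabilities of single discrete paths. Summing them over the finitely
  many paths through the sets \<open>B j\<close> gives the Markov property for events of the past. Prescribing
  the present state, as \<open>B k\<close> does, makes the last transition probability a common factor.
\<close>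

lemma markov_property:
  fixes t :: "nat \<Rightarrow> real"
  assumes t: "t 0 = 0" "\<And>k. t k \<le> t (Suc k)"
    and B: "\<And>j. j \<le> k \<Longrightarrow> B j \<subseteq> configs V" "B k = {\<xi>}" and \<zeta>: "\<zeta> \<in> configs V"
  shows "prob {\<omega> \<in> space M. (\<forall>j\<le>k. \<eta> (t j) \<omega> \<in> B j) \<and> \<eta> (t (Suc k)) \<omega> = \<zeta>}
    = prob {\<omega> \<in> space M. \<forall>j\<le>k. \<eta> (t j) \<omega> \<in> B j} * transition_prob V c (t (Suc k) - t k) \<xi> \<zeta>"
proof -
  define paths where "paths = PiE {..k} B"
  have t0: "0 \<le> t j" for j
    using t by (induction j) (auto intro: order_trans)
  have "finite (B j)" if "j \<le> k" for j
    using B(1) [OF that] finite_configs [OF finite_sites] by (rule finite_subset)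
  then have fin: "finite paths"
    unfolding paths_def by (intro finite_PiE) auto
  have event: "{\<omega> \<in> space M. (\<forall>j\<le>n. \<eta> (t j) \<omega> = \<pi> j)} \<in> events" for \<pi> n
    by (rule all_states_event [OF t0])
  have event': "{\<omega> \<in> space M. (\<forall>j\<le>n. \<eta> (t j) \<omega> = \<pi> j) \<and> \<eta> (t i) \<omega> = \<zeta>} \<in> events" for \<pi> n i
    by (intro sets.sets_Collect_conj event state_event t0)
  have event_B: "{\<omega> \<in> space M. (\<forall>j\<le>k. \<eta> (t j) \<omega> \<in> B j)} \<in> events"
    by (rule all_states_event [OF t0])
  have event_B': "{\<omega> \<in> space M. (\<forall>j\<le>k. \<eta> (t j) \<omega> \<in> B j) \<and> \<eta> (t (Suc k)) \<omega> = \<zeta>} \<in> events"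
    by (intro sets.sets_Collect_conj event_B state_event t0)
  have unique: "\<exists>!\<pi>. \<pi> \<in> paths \<and> (\<forall>j\<le>k. \<eta> (t j) \<omega> = \<pi> j)"
    if "\<forall>j\<le>k. \<eta> (t j) \<omega> \<in> B j" for \<omega>
  proof (rule ex1I [of _ "\<lambda>j\<in>{..k}. \<eta> (t j) \<omega>"])
    fix \<pi> assume "\<pi> \<in> paths \<and> (\<forall>j\<le>k. \<eta> (t j) \<omega> = \<pi> j)"
    then show "\<pi> = (\<lambda>j\<in>{..k}. \<eta> (t j) \<omega>)"
      unfolding paths_def by (intro ext) (auto simp: PiE_def extensional_def)
  qed (use that in \<open>auto simp: paths_def\<close>)
  have in_B: "\<pi> j \<in> B j" if "\<pi> \<in> paths" "j \<le> k" for \<pi> j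
    using that by (auto simp: paths_def)
  have partition: "(\<forall>\<pi>\<in>paths. (\<forall>j\<le>k. \<eta> (t j) \<omega> = \<pi> j) \<longrightarrow> (\<forall>j\<le>k. \<eta> (t j) \<omega> \<in> B j)) \<and>
      ((\<forall>j\<le>k. \<eta> (t j) \<omega> \<in> B j) \<longrightarrow> (\<exists>!\<pi>\<in>paths. \<forall>j\<le>k. \<eta> (t j) \<omega> = \<pi> j))" for \<omega>
    using unique [of \<omega>] in_B by simp
  have now: "prob {\<omega> \<in> space M. \<forall>j\<le>k. \<eta> (t j) \<omega> \<in> B j}
      = (\<Sum>\<pi>\<in>paths. prob {\<omega> \<in> space M. \<forall>j\<le>k. \<eta> (t j) \<omega> = \<pi> j})"
    by (intro prob_sum fin event event_B AE_I2 partition)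
  have "prob {\<omega> \<in> space M. (\<forall>j\<le>k. \<eta> (t j) \<omega> \<in> B j) \<and> \<eta> (t (Suc k)) \<omega> = \<zeta>}
      = (\<Sum>\<pi>\<in>paths. prob {\<omega> \<in> space M. (\<forall>j\<le>k. \<eta> (t j) \<omega> = \<pi> j) \<and> \<eta> (t (Suc k)) \<omega> = \<zeta>})"
  proof (intro prob_sum fin event' event_B' AE_I2)
    fix \<omega>
    show "(\<forall>\<pi>\<in>paths. (\<forall>j\<le>k. \<eta> (t j) \<omega> = \<pi> j) \<and> \<eta> (t (Suc k)) \<omega> = \<zeta>
          \<longrightarrow> (\<forall>j\<le>k. \<eta> (t j) \<omega> \<in> B j) \<and> \<eta> (t (Suc k)) \<omega> = \<zeta>) \<and>
        ((\<forall>j\<le>k. \<eta> (t j) \<omega> \<in> B j) \<and> \<eta> (t (Suc k)) \<omega> = \<zeta>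
          \<longrightarrow> (\<exists>!\<pi>\<in>paths. (\<forall>j\<le>k. \<eta> (t j) \<omega> = \<pi> j) \<and> \<eta> (t (Suc k)) \<omega> = \<zeta>))"
      using partition [of \<omega>] by (cases "\<eta> (t (Suc k)) \<omega> = \<zeta>") simp_all
  qed
  also have "\<dots> = (\<Sum>\<pi>\<in>paths. prob {\<omega> \<in> space M. \<forall>j\<le>k. \<eta> (t j) \<omega> = \<pi> j}
      * transition_prob V c (t (Suc k) - t k) \<xi> \<zeta>)"
  proof (rule sum.cong [OF refl])
    fix \<pi> assume \<pi>: "\<pi> \<in> paths"
    have fdd: "prob {\<omega> \<in> space M. \<forall>j\<le>n. \<eta> (t j) \<omega> = \<rho> j} = prob {\<omega> \<in> space M. \<eta> 0 \<omega> = \<rho> 0}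
        * (\<Prod>j<n. transition_prob V c (t (Suc j) - t j) (\<rho> j) (\<rho> (Suc j)))"
      if "\<And>j. j \<le> n \<Longrightarrow> \<rho> j \<in> configs V" for \<rho> n
      using process that t unfolding flip_process_def by blast
    let ?\<rho> = "\<pi>(Suc k := \<zeta>)"
    have \<pi>C: "\<pi> j \<in> configs V" if "j \<le> k" for j
      using in_B [OF \<pi> that] B(1) [OF that] by blast
    have "\<pi> k = \<xi>" using in_B [OF \<pi>, of k] B(2) by simp
    have "{\<omega> \<in> space M. (\<forall>j\<le>k. \<eta> (t j) \<omega> = \<pi> j) \<and> \<eta> (t (Suc k)) \<omega> = \<zeta>}
        = {\<omega> \<in> space M. \<forall>j\<le>Suc k. \<eta> (t j) \<omega> = ?\<rho> j}"
      by (auto simp: le_Suc_eq)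
    then have "prob {\<omega> \<in> space M. (\<forall>j\<le>k. \<eta> (t j) \<omega> = \<pi> j) \<and> \<eta> (t (Suc k)) \<omega> = \<zeta>}
        = prob {\<omega> \<in> space M. \<forall>j\<le>Suc k. \<eta> (t j) \<omega> = ?\<rho> j}"
      by (rule arg_cong)
    also have "\<dots> = prob {\<omega> \<in> space M. \<eta> 0 \<omega> = ?\<rho> 0}
        * (\<Prod>j<Suc k. transition_prob V c (t (Suc j) - t j) (?\<rho> j) (?\<rho> (Suc j)))"
      using \<pi>C \<zeta> by (intro fdd) auto
    also have "\<dots> = prob {\<omega> \<in> space M. \<eta> 0 \<omega> = \<pi> 0}
        * (\<Prod>j<k. transition_prob V c (t (Suc j) - t j) (\<pi> j) (\<pi> (Suc j)))
        * transition_prob V c (t (Suc k) - t k) \<xi> \<zeta>"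
    proof -
      have "(\<Prod>j<k. transition_prob V c (t (Suc j) - t j) (?\<rho> j) (?\<rho> (Suc j)))
          = (\<Prod>j<k. transition_prob V c (t (Suc j) - t j) (\<pi> j) (\<pi> (Suc j)))"
        by (intro prod.cong) auto
      moreover have "?\<rho> 0 = \<pi> 0" "?\<rho> k = \<xi>" "?\<rho> (Suc k) = \<zeta>"
        using \<open>\<pi> k = \<xi>\<close> by auto
      ultimately show ?thesis
        by (simp only: prod.lessThan_Suc mult.assoc)
    qed
    also have "prob {\<omega> \<in> space M. \<eta> 0 \<omega> = \<pi> 0}
        * (\<Prod>j<k. transition_prob V c (t (Suc j) - t j) (\<pi> j) (\<pi> (Suc j)))
        = prob {\<omega> \<in> space M. \<forall>j\<le>k. \<eta> (t j) \<omega> = \<pi> j}"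
      using \<pi>C by (intro fdd [symmetric])
    finally show "prob {\<omega> \<in> space M. (\<forall>j\<le>k. \<eta> (t j) \<omega> = \<pi> j) \<and> \<eta> (t (Suc k)) \<omega> = \<zeta>}
        = prob {\<omega> \<in> space M. \<forall>j\<le>k. \<eta> (t j) \<omega> = \<pi> j}
          * transition_prob V c (t (Suc k) - t k) \<xi> \<zeta>" .
  qed
  finally show ?thesis
    by (simp add: now sum_distrib_right)
qed

text \<open>
  This is Ville's inequality for nonnegative supermartingales. The sum of \<open>a\<close> times the
  probability that the level \<open>a\<close> was reached before step \<open>k\<close> and of the expectation of
  \<open>g k\<close> on the event that it was not is nonincreasing in \<open>k\<close>: trajectories that first
  reach the level at step \<open>k\<close> have \<open>g k \<ge> a\<close>, and on the other trajectories one step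
  of the chain does not increase the expectation.
\<close>

lemma discrete_maximal_inequality:
  fixes t :: "nat \<Rightarrow> real" and g :: "nat \<Rightarrow> config \<Rightarrow> real"
  assumes t: "t 0 = 0" "\<And>k. t k \<le> t (Suc k)"
    and g_nonneg: "\<And>k \<xi>. k \<le> n \<Longrightarrow> \<xi> \<in> configs V \<Longrightarrow> 0 \<le> g k \<xi>"
    and super: "\<And>k \<xi>. k < n \<Longrightarrow> \<xi> \<in> configs V \<Longrightarrow>
      (\<Sum>\<zeta>\<in>configs V. transition_prob V c (t (Suc k) - t k) \<xi> \<zeta> * g (Suc k) \<zeta>) \<le> g k \<xi>"
  shows "a * prob {\<omega> \<in> space M. \<exists>j\<le>n. a \<le> g j (\<eta> (t j) \<omega>)}
    \<le> (\<Sum>\<xi>\<in>configs V. prob {\<omega> \<in> space M. \<eta> 0 \<omega> = \<xi>} * g 0 \<xi>)"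
proof -
  have t0: "0 \<le> t j" for j
    using t by (induction j) (auto intro: order_trans)
  have fin: "finite (configs V)"
    by (rule finite_configs [OF finite_sites])
  let ?high = "\<lambda>k. {\<xi> \<in> configs V. a \<le> g k \<xi>}" and ?low = "\<lambda>k. {\<xi> \<in> configs V. g k \<xi> < a}"
  define hit where "hit k = prob {\<omega> \<in> space M. \<exists>j<k. a \<le> g j (\<eta> (t j) \<omega>)}" for k
  \<comment> \<open>the sub-probability law at step k of the trajectories that have stayed below the level
    a before step k\<close>
  define m where
    "m k \<xi> = prob {\<omega> \<in> space M. (\<forall>j<k. g j (\<eta> (t j) \<omega>) < a) \<and> \<eta> (t k) \<omega> = \<xi>}" for k \<xi>
  define u where "u k = (\<Sum>\<xi>\<in>configs V. m k \<xi> * g k \<xi>)" for k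
  have event: "{\<omega> \<in> space M. (\<forall>j<k. g j (\<eta> (t j) \<omega>) < a)} \<in> events" for k
    by (rule all_states_event [OF t0])
  have event_m: "{\<omega> \<in> space M. (\<forall>j<k. g j (\<eta> (t j) \<omega>) < a) \<and> \<eta> (t k) \<omega> = \<xi>} \<in> events" for k \<xi>
    by (intro sets.sets_Collect_conj event state_event t0)
  have event_hit: "{\<omega> \<in> space M. \<exists>j<k. a \<le> g j (\<eta> (t j) \<omega>)} \<in> events" for k
    by (rule some_state_event [OF t0])
  have m_nonneg: "0 \<le> m k \<xi>" for k \<xi>
    by (simp add: m_def)
  have hit_Suc: "hit (Suc k) = hit k + (\<Sum>\<xi>\<in>?high k. m k \<xi>)" for k
  proof -
    let ?new = "{\<omega> \<in> space M. (\<forall>j<k. g j (\<eta> (t j) \<omega>) < a) \<and> a \<le> g k (\<eta> (t k) \<omega>)}"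
    have "{\<omega> \<in> space M. \<exists>j<Suc k. a \<le> g j (\<eta> (t j) \<omega>)}
        = {\<omega> \<in> space M. \<exists>j<k. a \<le> g j (\<eta> (t j) \<omega>)} \<union> ?new"
      by (auto simp: less_Suc_eq not_less)
    moreover have "prob ({\<omega> \<in> space M. \<exists>j<k. a \<le> g j (\<eta> (t j) \<omega>)} \<union> ?new)
        = hit k + prob ?new"
      unfolding hit_def
      by (intro finite_measure_Union event_hit sets.sets_Collect_conj event state_event t0) auto
    moreover have "prob ?new = (\<Sum>\<xi>\<in>?high k. m k \<xi>)"
      unfolding m_def
      using state_in_configs [OF t0] fin
      by (intro prob_sum event_m sets.sets_Collect_conj event state_event t0 AE_I2) auto
    ultimately show ?thesis by (simp add: hit_def)
  qed
  have m_Suc: "m (Suc k) \<zeta>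
      = (\<Sum>\<xi>\<in>?low k. m k \<xi> * transition_prob V c (t (Suc k) - t k) \<xi> \<zeta>)"
    if \<zeta>: "\<zeta> \<in> configs V" for k \<zeta>
  proof -
    have "m (Suc k) \<zeta> = (\<Sum>\<xi>\<in>?low k. prob {\<omega> \<in> space M.
        ((\<forall>j<k. g j (\<eta> (t j) \<omega>) < a) \<and> \<eta> (t k) \<omega> = \<xi>) \<and> \<eta> (t (Suc k)) \<omega> = \<zeta>})"
      unfolding m_def
    proof (rule prob_sum)
      show "{\<omega> \<in> space M. ((\<forall>j<k. g j (\<eta> (t j) \<omega>) < a) \<and> \<eta> (t k) \<omega> = \<xi>)
          \<and> \<eta> (t (Suc k)) \<omega> = \<zeta>} \<in> events" for \<xi>
        by (intro sets.sets_Collect_conj [OF _ event_m] state_event t0)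
      show "AE \<omega> in M. (\<forall>\<xi>\<in>?low k. ((\<forall>j<k. g j (\<eta> (t j) \<omega>) < a) \<and> \<eta> (t k) \<omega> = \<xi>)
              \<and> \<eta> (t (Suc k)) \<omega> = \<zeta>
            \<longrightarrow> (\<forall>j<Suc k. g j (\<eta> (t j) \<omega>) < a) \<and> \<eta> (t (Suc k)) \<omega> = \<zeta>) \<and>
          ((\<forall>j<Suc k. g j (\<eta> (t j) \<omega>) < a) \<and> \<eta> (t (Suc k)) \<omega> = \<zeta>
            \<longrightarrow> (\<exists>!\<xi>\<in>?low k. ((\<forall>j<k. g j (\<eta> (t j) \<omega>) < a) \<and> \<eta> (t k) \<omega> = \<xi>)
              \<and> \<eta> (t (Suc k)) \<omega> = \<zeta>))"
        using state_in_configs [OF t0] by (intro AE_I2) (auto simp: less_Suc_eq)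
    qed (use fin in simp, rule event_m)
    also have "\<dots> = (\<Sum>\<xi>\<in>?low k. m k \<xi> * transition_prob V c (t (Suc k) - t k) \<xi> \<zeta>)"
    proof (rule sum.cong [OF refl])
      fix \<xi> assume \<xi>: "\<xi> \<in> ?low k"
      let ?B = "\<lambda>j. if j = k then {\<xi>} else ?low j"
      have *: "(\<forall>j<k. g j (\<eta> (t j) \<omega>) < a) \<and> \<eta> (t k) \<omega> = \<xi> \<longleftrightarrow> (\<forall>j\<le>k. \<eta> (t j) \<omega> \<in> ?B j)"
        if "\<omega> \<in> space M" for \<omega>
        using state_in_configs [OF t0 that] by (auto simp: le_less)
      have "prob {\<omega> \<in> space M. (\<forall>j\<le>k. \<eta> (t j) \<omega> \<in> ?B j) \<and> \<eta> (t (Suc k)) \<omega> = \<zeta>}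
          = prob {\<omega> \<in> space M. \<forall>j\<le>k. \<eta> (t j) \<omega> \<in> ?B j}
            * transition_prob V c (t (Suc k) - t k) \<xi> \<zeta>"
        using \<xi> by (intro markov_property t \<zeta>) auto
      then show "prob {\<omega> \<in> space M.
          ((\<forall>j<k. g j (\<eta> (t j) \<omega>) < a) \<and> \<eta> (t k) \<omega> = \<xi>) \<and> \<eta> (t (Suc k)) \<omega> = \<zeta>}
          = m k \<xi> * transition_prob V c (t (Suc k) - t k) \<xi> \<zeta>"
        unfolding m_def by (simp only: * cong: conj_cong)
    qed
    finally show ?thesis .
  qed
  have split: "(\<Sum>\<xi>\<in>configs V. f \<xi>) = (\<Sum>\<xi>\<in>?low k. f \<xi>) + (\<Sum>\<xi>\<in>?high k. f \<xi>)"
    for f :: "config \<Rightarrow> real" and k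
    using fin by (subst sum.union_disjoint [symmetric]) (auto intro!: sum.cong)
  have high: "a * (\<Sum>\<xi>\<in>?high k. m k \<xi>) \<le> (\<Sum>\<xi>\<in>?high k. m k \<xi> * g k \<xi>)" for k
    unfolding sum_distrib_left
    by (intro sum_mono) (auto simp: mult.commute [of a] intro!: mult_left_mono m_nonneg)
  have u_Suc: "u (Suc k) \<le> (\<Sum>\<xi>\<in>?low k. m k \<xi> * g k \<xi>)" if "k < n" for k
  proof -
    have "u (Suc k) = (\<Sum>\<xi>\<in>?low k. m k \<xi> *
        (\<Sum>\<zeta>\<in>configs V. transition_prob V c (t (Suc k) - t k) \<xi> \<zeta> * g (Suc k) \<zeta>))"
      unfolding u_def by (simp add: m_Suc sum_distrib_left sum_distrib_right mult.assoc)
        (rule sum.swap)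
    also have "\<dots> \<le> (\<Sum>\<xi>\<in>?low k. m k \<xi> * g k \<xi>)"
      using super [OF that] by (intro sum_mono mult_left_mono m_nonneg) auto
    finally show ?thesis .
  qed
  have bound: "a * hit k + u k \<le> u 0" if "k \<le> n" for k
    using that
  proof (induction k)
    case 0
    then show ?case by (simp add: hit_def)
  next
    case (Suc k)
    then show ?case
      using u_Suc [of k] high [of k] split [of "\<lambda>\<xi>. m k \<xi> * g k \<xi>" k]
      by (simp add: hit_Suc u_def algebra_simps)
  qed
  have "0 \<le> (\<Sum>\<xi>\<in>?low n. m n \<xi> * g n \<xi>)"
    using g_nonneg m_nonneg by (intro sum_nonneg mult_nonneg_nonneg) auto
  then have "a * hit (Suc n) \<le> u 0"
    using bound [of n] high [of n] split [of "\<lambda>\<xi>. m n \<xi> * g n \<xi>" n]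
    by (simp add: hit_Suc u_def algebra_simps)
  then show ?thesis
    by (simp add: hit_def u_def m_def t(1) less_Suc_eq_le)
qed

end

section \<open>From time grids to the whole interval\<close>

context flip_system
begin

lemma paths_right_constant:
  assumes "0 \<le> t" "\<omega> \<in> space M"
  shows "\<forall>\<^sub>F s in at_right t. \<eta> s \<omega> = \<eta> t \<omega>"
  using process assms unfolding flip_process_def by blast

text \<open>
  A supremum of reals is meaningful only for nonempty bounded sets. Here only finitely many
  configurations occur, and each contributes a continuous function on a compact interval.
\<close>

lemma bdd_above_along_path:
  fixes F :: "real \<Rightarrow> config \<Rightarrow> real"
  assumes cont: "\<And>\<xi>. continuous_on UNIV (\<lambda>t. F t \<xi>)" and \<omega>: "\<omega> \<in> space M"
  shows "bdd_above ((\<lambda>t. F t (\<eta> t \<omega>)) ` {0..T})"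
proof (rule bdd_above_mono)
  have "bdd_above ((\<lambda>t. F t \<xi>) ` {0..T})" for \<xi>
    by (intro bounded_imp_bdd_above compact_imp_bounded compact_continuous_image
        continuous_on_subset [OF cont]) auto
  then show "bdd_above (\<Union>\<xi>\<in>configs V. (\<lambda>t. F t \<xi>) ` {0..T})"
    using finite_configs [OF finite_sites] by simp
  show "(\<lambda>t. F t (\<eta> t \<omega>)) ` {0..T} \<subseteq> (\<Union>\<xi>\<in>configs V. (\<lambda>t. F t \<xi>) ` {0..T})"
    using state_in_configs [OF _ \<omega>] by fastforce
qed

text \<open>
  The grids are dyadic so that they are nested, which makes these events increase with \<open>m\<close>.
\<close>

definition exceeds :: "real \<Rightarrow> (real \<Rightarrow> config \<Rightarrow> real) \<Rightarrow> real \<Rightarrow> nat \<Rightarrow> 'w set" where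
  "exceeds T F b m = {\<omega> \<in> space M. \<exists>j::nat. j \<le> 2 ^ m \<and> b < F (real j * T / 2 ^ m) (\<eta> (real j * T / 2 ^ m) \<omega>)}"

lemma exceeds_event:
  assumes "0 \<le> T"
  shows "exceeds T F b m \<in> events"
  unfolding exceeds_def
  by (rule some_state_event [where P = "\<lambda>j \<xi>. b < F (real j * T / 2 ^ m) \<xi>"])
     (use assms in simp)

lemma incseq_exceeds: "incseq (exceeds T F b)"
proof (rule incseq_SucI, rule subsetI)
  fix m \<omega> assume "\<omega> \<in> exceeds T F b m"
  then obtain j where "\<omega> \<in> space M" "j \<le> (2 ^ m :: nat)"
      "b < F (real j * T / 2 ^ m) (\<eta> (real j * T / 2 ^ m) \<omega>)"
    by (auto simp: exceeds_def)
  moreover have "real (2 * j) * T / 2 ^ Suc m = real j * T / 2 ^ m"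
    by simp
  moreover have "2 * j \<le> 2 ^ Suc m"
    using \<open>j \<le> 2 ^ m\<close> by simp
  ultimately show "\<omega> \<in> exceeds T F b (Suc m)"
    unfolding exceeds_def by (intro CollectI conjI exI [of _ "2 * j"]) (simp_all only:)
qed

text \<open>
  A strict inequality at some time persists for a short time afterwards, since paths are constant on a
  right neighbourhood and \<open>F\<close> is continuous in time. So it also occurs at a dyadic time. The
  end point \<open>T\<close>, which has no right neighbourhood in the interval, belongs to every grid.
\<close>

lemma SUP_greater_iff_exceeds:
  fixes F :: "real \<Rightarrow> config \<Rightarrow> real"
  assumes cont: "\<And>\<xi>. continuous_on UNIV (\<lambda>t. F t \<xi>)" and T: "0 < T"
  shows "{\<omega> \<in> space M. b < (SUP t\<in>{0..T}. F t (\<eta> t \<omega>))} = (\<Union>m. exceeds T F b m)"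
proof (intro set_eqI iffI)
  fix \<omega> assume "\<omega> \<in> {\<omega> \<in> space M. b < (SUP t\<in>{0..T}. F t (\<eta> t \<omega>))}"
  then have \<omega>: "\<omega> \<in> space M" and "b < (SUP t\<in>{0..T}. F t (\<eta> t \<omega>))"
    by auto
  then have "\<exists>t\<in>{0..T}. b < F t (\<eta> t \<omega>)"
    using less_cSUP_iff [OF _ bdd_above_along_path [where F = F, OF cont \<omega>], of T b] T by simp
  then obtain t where t: "0 \<le> t" "t \<le> T" and b: "b < F t (\<eta> t \<omega>)"
    by auto
  show "\<omega> \<in> (\<Union>m. exceeds T F b m)"
  proof (cases "t = T")
    case True
    then have "\<omega> \<in> exceeds T F b 0"
      using b \<omega> by (auto simp: exceeds_def intro!: exI [of _ "1::nat"])
    then show ?thesis by blast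
  next
    case False
    have "((\<lambda>s. F s (\<eta> t \<omega>)) \<longlongrightarrow> F t (\<eta> t \<omega>)) (at_right t)"
      using cont [of "\<eta> t \<omega>"] by (auto simp: continuous_on_def intro: tendsto_within_subset)
    then have "\<forall>\<^sub>F s in at_right t. b < F s (\<eta> t \<omega>)"
      using b by (rule order_tendstoD)
    with paths_right_constant [OF \<open>0 \<le> t\<close> \<omega>]
    have "\<forall>\<^sub>F s in at_right t. b < F s (\<eta> s \<omega>)"
      by eventually_elim simp
    then obtain e where e: "t < e" "\<And>s. t < s \<Longrightarrow> s < e \<Longrightarrow> b < F s (\<eta> s \<omega>)"
      by (auto simp: eventually_at_right_field)
    define e' where "e' = min e T"
    have "t < e'" using e(1) False t by (simp add: e'_def)
    then obtain m where m: "(1 / 2) ^ m < (e' - t) / T"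
      using real_arch_pow_inv [of "(e' - t) / T" "1 / 2"] T by auto
    \<comment> \<open>the first grid point after t; the mesh T / 2 ^ m is smaller than e' - t\<close>
    define j where "j = nat \<lfloor>t * 2 ^ m / T\<rfloor> + 1"
    have "0 \<le> t * 2 ^ m / T" using t T by simp
    then have j: "real j = of_int \<lfloor>t * 2 ^ m / T\<rfloor> + 1"
      by (simp add: j_def)
    have "t * 2 ^ m / T < real j" "real j \<le> t * 2 ^ m / T + 1"
      unfolding j by linarith+
    then have "t < real j * T / 2 ^ m" "real j * T / 2 ^ m \<le> t + T / 2 ^ m"
      using T by (simp_all add: field_simps)
    moreover have "t + T / 2 ^ m < e'"
      using m T by (simp add: field_simps power_divide)
    ultimately have s: "t < real j * T / 2 ^ m" "real j * T / 2 ^ m < e" "real j * T / 2 ^ m < T"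
      by (simp_all add: e'_def)
    then have "real j < 2 ^ m"
      using T by (simp add: field_simps)
    then have "j \<le> 2 ^ m"
      by (simp add: of_nat_less_numeral_power_cancel_iff)
    then have "\<omega> \<in> exceeds T F b m"
      unfolding exceeds_def using \<omega> e(2) [OF s(1,2)] by blast
    then show ?thesis by blast
  qed
next
  fix \<omega> assume "\<omega> \<in> (\<Union>m. exceeds T F b m)"
  then obtain m j where \<omega>: "\<omega> \<in> space M" and j: "j \<le> (2 ^ m :: nat)"
      and b: "b < F (real j * T / 2 ^ m) (\<eta> (real j * T / 2 ^ m) \<omega>)"
    by (auto simp: exceeds_def)
  have "real j \<le> 2 ^ m"
    using j by (metis of_nat_le_iff of_nat_numeral of_nat_power)
  then have "real j * T / 2 ^ m \<in> {0..T}"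
    using T by (simp add: field_simps)
  then show "\<omega> \<in> {\<omega> \<in> space M. b < (SUP t\<in>{0..T}. F t (\<eta> t \<omega>))}"
    using b \<omega> less_cSUP_iff [OF _ bdd_above_along_path [where F = F, OF cont \<omega>], of T b] T by auto
qed

lemma measurable_SUP_along_path:
  fixes F :: "real \<Rightarrow> config \<Rightarrow> real"
  assumes cont: "\<And>\<xi>. continuous_on UNIV (\<lambda>t. F t \<xi>)" and T: "0 < T"
  shows "(\<lambda>\<omega>. SUP t\<in>{0..T}. F t (\<eta> t \<omega>)) \<in> borel_measurable M"
proof (subst borel_measurable_iff_greater, intro allI)
  show "{\<omega> \<in> space M. b < (SUP t\<in>{0..T}. F t (\<eta> t \<omega>))} \<in> events" for b
    unfolding SUP_greater_iff_exceeds [where F = F, OF cont T]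
    using exceeds_event T by (intro sets.countable_UN) auto
qed

text \<open>
  The supermartingale inequality on the dyadic grids passes to the whole interval by continuity of
  the measure from below. The function \<open>F\<close> is the quantity of interest, and \<open>G\<close> is the
  supermartingale that is large wherever \<open>F\<close> is.
\<close>

lemma maximal_inequality:
  fixes F G G' :: "real \<Rightarrow> config \<Rightarrow> real"
  assumes cont: "\<And>\<xi>. continuous_on UNIV (\<lambda>t. F t \<xi>)" and T: "0 < T" and "0 \<le> a"
    and nonneg: "\<And>t \<xi>. 0 \<le> t \<Longrightarrow> t \<le> T \<Longrightarrow> \<xi> \<in> configs V \<Longrightarrow> 0 \<le> G t \<xi>"
    and deriv: "\<And>t \<xi>. 0 \<le> t \<Longrightarrow> t \<le> T \<Longrightarrow> \<xi> \<in> configs V \<Longrightarrow>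
      ((\<lambda>t. G t \<xi>) has_real_derivative G' t \<xi>) (at t)"
    and drift: "\<And>t \<xi>. 0 \<le> t \<Longrightarrow> t \<le> T \<Longrightarrow> \<xi> \<in> configs V \<Longrightarrow>
      G' t \<xi> + flip_generator V c (G t) \<xi> \<le> 0"
    and large: "\<And>t \<xi>. 0 \<le> t \<Longrightarrow> t \<le> T \<Longrightarrow> \<xi> \<in> configs V \<Longrightarrow> b < F t \<xi> \<Longrightarrow> a \<le> G t \<xi>"
  shows "a * prob {\<omega> \<in> space M. b < (SUP t\<in>{0..T}. F t (\<eta> t \<omega>))}
    \<le> (\<Sum>\<xi>\<in>configs V. prob {\<omega> \<in> space M. \<eta> 0 \<omega> = \<xi>} * G 0 \<xi>)"
proof -
  have "a * prob (exceeds T F b m) \<le> (\<Sum>\<xi>\<in>configs V. prob {\<omega> \<in> space M. \<eta> 0 \<omega> = \<xi>} * G 0 \<xi>)" for m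
  proof -
    define t where "t j = real j * T / 2 ^ m" for j
    have t: "t 0 = 0" "\<And>k. t k \<le> t (Suc k)" "\<And>k. 0 \<le> t k"
      using T by (auto simp: t_def divide_right_mono)
    have le_T: "t k \<le> T" if "k \<le> 2 ^ m" for k
    proof -
      have "real k \<le> 2 ^ m"
        using that by (metis of_nat_le_iff of_nat_numeral of_nat_power)
      then show ?thesis using T by (simp add: t_def field_simps)
    qed
    have "exceeds T F b m \<subseteq> {\<omega> \<in> space M. \<exists>j\<le>2 ^ m. a \<le> G (t j) (\<eta> (t j) \<omega>)}"
      using large [OF t(3) le_T state_in_configs [OF t(3)]] unfolding exceeds_def t_def by blast
    then have "a * prob (exceeds T F b m)
        \<le> a * prob {\<omega> \<in> space M. \<exists>j\<le>2 ^ m. a \<le> G (t j) (\<eta> (t j) \<omega>)}"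
      using \<open>0 \<le> a\<close> by (intro mult_left_mono finite_measure_mono some_state_event t)
    also have "\<dots> \<le> (\<Sum>\<xi>\<in>configs V. prob {\<omega> \<in> space M. \<eta> 0 \<omega> = \<xi>} * G (t 0) \<xi>)"
    proof (rule discrete_maximal_inequality [OF t(1,2), where g = "\<lambda>k. G (t k)"])
      fix k \<xi> assume k: "k < (2 ^ m :: nat)" and \<xi>: "\<xi> \<in> configs V"
      have "t (Suc k) \<le> T" "0 \<le> t k"
        using k le_T [of "Suc k"] t(3) by auto
      then show "(\<Sum>\<zeta>\<in>configs V. transition_prob V c (t (Suc k) - t k) \<xi> \<zeta> * G (t (Suc k)) \<zeta>)
          \<le> G (t k) \<xi>"
        by (intro transition_prob_superharmonic [where G' = G'] t(2) \<xi> deriv drift) auto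
    qed (use nonneg t(3) le_T in auto)
    finally show ?thesis by (simp add: t(1))
  qed
  moreover have "(\<lambda>m. a * prob (exceeds T F b m)) \<longlonglongrightarrow> a * prob (\<Union>m. exceeds T F b m)"
    using exceeds_event T by (intro tendsto_mult_left finite_Lim_measure_incseq incseq_exceeds) auto
  ultimately show ?thesis
    unfolding SUP_greater_iff_exceeds [where F = F, OF cont T] by (intro LIMSEQ_le_const2) auto
qed

end

section \<open>Neighbours in the torus\<close>

lemma finite_torus: "finite (torus d r)"
  unfolding torus_def by (intro finite_PiE) auto

lemma card_torus: "card (torus d r) = r ^ d"
  unfolding torus_def by (subst card_PiE) auto

definition unshift :: "nat \<Rightarrow> nat \<Rightarrow> vertex \<Rightarrow> vertex" where
  "unshift r i x = x(i := if 1 < x i then x i - 1 else r)"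

lemma torus_coord: "x \<in> torus d r \<Longrightarrow> i \<in> {1..d} \<Longrightarrow> 1 \<le> x i \<and> x i \<le> r"
  by (auto simp: torus_def PiE_iff)

lemma shift_in_torus:
  assumes "x \<in> torus d r" "i \<in> {1..d}"
  shows "shift r i x \<in> torus d r"
  using assms torus_coord [OF assms] by (auto simp: torus_def shift_def PiE_iff extensional_def)

lemma unshift_in_torus:
  assumes "x \<in> torus d r" "i \<in> {1..d}"
  shows "unshift r i x \<in> torus d r"
  using assms torus_coord [OF assms]
  by (auto simp: torus_def unshift_def PiE_iff extensional_def intro: order_trans [OF diff_le_self])

lemma unshift_shift: "x \<in> torus d r \<Longrightarrow> i \<in> {1..d} \<Longrightarrow> unshift r i (shift r i x) = x"
  using torus_coord [of x d r i] by (auto simp: shift_def unshift_def)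

lemma shift_unshift: "x \<in> torus d r \<Longrightarrow> i \<in> {1..d} \<Longrightarrow> shift r i (unshift r i x) = x"
  using torus_coord [of x d r i] by (auto simp: shift_def unshift_def)

lemma bij_betw_shift: "i \<in> {1..d} \<Longrightarrow> bij_betw (shift r i) (torus d r) (torus d r)"
  by (rule bij_betw_byWitness [where f' = "unshift r i"])
     (auto simp: shift_in_torus unshift_in_torus unshift_shift shift_unshift)

lemma bij_betw_unshift: "i \<in> {1..d} \<Longrightarrow> bij_betw (unshift r i) (torus d r) (torus d r)"
  by (rule bij_betw_byWitness [where f' = "shift r i"])
     (auto simp: shift_in_torus unshift_in_torus unshift_shift shift_unshift)

text \<open>
  The edges that arrive at \<open>x\<close> start at its backward neighbours. For \<open>r = 2\<close> forward and
  backward neighbours coincide, and both terms of the sum are kept.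
\<close>

lemma neighbour_sum_eq:
  assumes "x \<in> torus d r"
  shows "neighbour_sum d r x f = (\<Sum>i\<in>{1..d}. f (shift r i x) + f (unshift r i x))"
proof -
  have "{(z, i). z \<in> torus d r \<and> i \<in> {1..d} \<and> shift r i z = x} = (\<lambda>i. (unshift r i x, i)) ` {1..d}"
    using assms by (auto simp: unshift_shift shift_unshift unshift_in_torus image_iff)
  moreover have "inj_on (\<lambda>i. (unshift r i x, i)) {1..d}"
    by (auto simp: inj_on_def)
  ultimately show ?thesis
    by (simp add: neighbour_sum_def sum.reindex sum.distrib)
qed

lemma neighbour_sum_mono_torus:
  assumes "x \<in> torus d r" "\<And>y. y \<in> torus d r \<Longrightarrow> f y \<le> g y"
  shows "neighbour_sum d r x f \<le> neighbour_sum d r x g"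
  unfolding neighbour_sum_eq [OF assms(1)]
  using assms by (intro sum_mono add_mono) (auto simp: shift_in_torus unshift_in_torus)

lemma neighbour_sum_cong_torus:
  assumes "x \<in> torus d r" "\<And>y. y \<in> torus d r \<Longrightarrow> f y = g y"
  shows "neighbour_sum d r x f = neighbour_sum d r x g"
  using assms by (intro antisym neighbour_sum_mono_torus) auto

lemma neighbour_sum_add:
  "x \<in> torus d r \<Longrightarrow>
    neighbour_sum d r x (\<lambda>y. f y + g y) = neighbour_sum d r x f + neighbour_sum d r x g"
  by (simp add: neighbour_sum_eq sum.distrib algebra_simps)

lemma neighbour_sum_one: "x \<in> torus d r \<Longrightarrow> neighbour_sum d r x (\<lambda>_. 1) = 2 * d"
  by (simp add: neighbour_sum_eq)

text \<open>
  Double counting: every shift is a bijection of the torus, so each vertex is counted once for each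
  of its \<open>2d\<close> edges.
\<close>

lemma sum_neighbour_sum:
  "(\<Sum>x\<in>torus d r. neighbour_sum d r x f) = 2 * d * (\<Sum>x\<in>torus d r. f x)"
proof -
  have "(\<Sum>x\<in>torus d r. neighbour_sum d r x f)
      = (\<Sum>i\<in>{1..d}. \<Sum>x\<in>torus d r. f (shift r i x) + f (unshift r i x))"
    by (simp add: neighbour_sum_eq) (rule sum.swap)
  also have "\<dots> = (\<Sum>i\<in>{1..d}. 2 * (\<Sum>x\<in>torus d r. f x))"
  proof (rule sum.cong [OF refl])
    fix i assume "i \<in> {1..d}"
    then have "(\<Sum>x\<in>torus d r. f (shift r i x)) = (\<Sum>x\<in>torus d r. f x)"
        "(\<Sum>x\<in>torus d r. f (unshift r i x)) = (\<Sum>x\<in>torus d r. f x)"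
      using sum.reindex_bij_betw [OF bij_betw_shift, of i d f r]
        sum.reindex_bij_betw [OF bij_betw_unshift, of i d f r] by auto
    then show "(\<Sum>x\<in>torus d r. f (shift r i x) + f (unshift r i x)) = 2 * (\<Sum>x\<in>torus d r. f x)"
      by (simp add: sum.distrib)
  qed
  finally show ?thesis by simp
qed

lemma flip_rates_threshold: "flip_rates (torus d r) (threshold_rate d r)"
  by unfold_locales (auto simp: finite_torus threshold_rate_def)

lemma config_values: "\<xi> \<in> configs V \<Longrightarrow> x \<in> V \<Longrightarrow> \<xi> x = 0 \<or> \<xi> x = 1"
  by (auto simp: configs_def PiE_iff)

text \<open>
  All neighbour counts can be expressed by the number of ones, with multiplicity: since a vertex has
  exactly \<open>2d\<close> edges, having at least \<open>d\<close> zeros around it means having at most \<open>d\<close> ones.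
\<close>

lemma threshold_rate_eq:
  assumes \<xi>: "\<xi> \<in> configs (torus d r)" and x: "x \<in> torus d r"
  shows "threshold_rate d r x \<xi> =
    of_bool (if \<xi> x = 0 then d \<le> neighbour_sum d r x \<xi> else neighbour_sum d r x \<xi> \<le> d)"
proof (cases "\<xi> x = 0")
  case True
  have "neighbour_sum d r x (\<lambda>y. if \<xi> y \<noteq> \<xi> x then 1 else 0) = neighbour_sum d r x \<xi>"
    using config_values [OF \<xi>] True by (intro neighbour_sum_cong_torus x) force
  then show ?thesis using True by (simp add: threshold_rate_def)
next
  case False
  have "neighbour_sum d r x (\<lambda>y. if \<xi> y \<noteq> \<xi> x then 1 else 0) + neighbour_sum d r x \<xi>
      = neighbour_sum d r x (\<lambda>_. 1)"
    unfolding neighbour_sum_add [OF x, symmetric]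
  proof (rule neighbour_sum_cong_torus [OF x])
    fix y assume "y \<in> torus d r"
    then show "(if \<xi> y \<noteq> \<xi> x then 1 else 0) + \<xi> y = 1"
      using config_values [OF \<xi>, of y] config_values [OF \<xi> x] False by auto
  qed
  then show ?thesis
    using False neighbour_sum_one [OF x] by (auto simp: threshold_rate_def)
qed

section \<open>A supermartingale for the threshold voter model\<close>

definition ones_density :: "nat \<Rightarrow> nat \<Rightarrow> config \<Rightarrow> real" where
  "ones_density d r \<xi> = (\<Sum>x\<in>torus d r. real (\<xi> x)) / real r ^ d"

lemma ones_density_eq_card_ones:
  assumes "\<xi> \<in> configs (torus d r)"
  shows "real (card (ones d r \<xi>)) / real r ^ d = ones_density d r \<xi>"
proof -
  have "(\<Sum>x\<in>torus d r. real (\<xi> x)) = (\<Sum>x\<in>torus d r. if \<xi> x = 1 then 1 else 0)"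
    using config_values [OF assms] by (intro sum.cong) force+
  also have "\<dots> = real (card (ones d r \<xi>))"
    by (simp add: sum.If_cases finite_torus ones_def Int_def)
  finally show ?thesis by (simp add: ones_density_def)
qed

lemma ones_density_bounds:
  assumes "1 \<le> r" "\<xi> \<in> configs (torus d r)"
  shows "0 \<le> ones_density d r \<xi>" "ones_density d r \<xi> \<le> 1"
proof -
  have "(\<Sum>x\<in>torus d r. real (\<xi> x)) \<le> (\<Sum>x\<in>torus d r. 1)"
    using config_values [OF assms(2)] by (intro sum_mono) force
  then show "ones_density d r \<xi> \<le> 1"
    using assms(1) by (simp add: ones_density_def card_torus)
qed (auto simp: ones_density_def intro!: divide_nonneg_nonneg sum_nonneg)

lemma ones_density_flip:
  assumes "\<xi> \<in> configs (torus d r)" "x \<in> torus d r"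
  shows "ones_density d r (flip x \<xi>) = ones_density d r \<xi> + (1 - 2 * real (\<xi> x)) / real r ^ d"
proof -
  have "(\<Sum>y\<in>torus d r. real (flip x \<xi> y)) = real (1 - \<xi> x) + (\<Sum>y\<in>torus d r - {x}. real (\<xi> y))"
    by (simp add: sum.remove [OF finite_torus assms(2)] flip_def)
  moreover have "(\<Sum>y\<in>torus d r. real (\<xi> y)) = real (\<xi> x) + (\<Sum>y\<in>torus d r - {x}. real (\<xi> y))"
    by (rule sum.remove [OF finite_torus assms(2)])
  moreover have "real (1 - \<xi> x) = real (\<xi> x) + (1 - 2 * real (\<xi> x))"
    using config_values [OF assms] by auto
  ultimately show ?thesis
    by (simp add: ones_density_def add_divide_distrib [symmetric])
qed

text \<open>
  A vertex that sees fewer than \<open>d\<close> ones flips at rate 1 if it is a one and keeps its value if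
  it is a zero, as in pure exponential decay. The fraction of the remaining vertices measures how far
  the dynamics is from that.
\<close>

definition crowded :: "nat \<Rightarrow> nat \<Rightarrow> config \<Rightarrow> real" where
  "crowded d r \<xi> = (\<Sum>x\<in>torus d r. of_bool (d \<le> neighbour_sum d r x \<xi>)) / real r ^ d"

text \<open>
  A vertex that is not crowded contributes exactly minus its value to the drift of the sum of all
  values. At a crowded vertex the difference is at most one, whatever the rate there.
\<close>

lemma ones_density_drift:
  assumes \<xi>: "\<xi> \<in> configs (torus d r)"
  shows "\<bar>flip_generator (torus d r) (threshold_rate d r) (ones_density d r) \<xi> + ones_density d r \<xi>\<bar>
    \<le> crowded d r \<xi>"
proof -
  have "flip_generator (torus d r) (threshold_rate d r) (ones_density d r) \<xi> + ones_density d r \<xi>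
      = (\<Sum>x\<in>torus d r. threshold_rate d r x \<xi> * (1 - 2 * real (\<xi> x)) + real (\<xi> x)) / real r ^ d"
    unfolding flip_generator_def
    by (simp add: ones_density_flip [OF \<xi>] sum.distrib add_divide_distrib sum_divide_distrib)
       (simp add: ones_density_def sum_divide_distrib)
  moreover have "\<bar>\<Sum>x\<in>torus d r. threshold_rate d r x \<xi> * (1 - 2 * real (\<xi> x)) + real (\<xi> x)\<bar>
      \<le> (\<Sum>x\<in>torus d r. of_bool (d \<le> neighbour_sum d r x \<xi>))"
  proof (intro order_trans [OF sum_abs] sum_mono)
    fix x assume x: "x \<in> torus d r"
    show "\<bar>threshold_rate d r x \<xi> * (1 - 2 * real (\<xi> x)) + real (\<xi> x)\<bar>
        \<le> of_bool (d \<le> neighbour_sum d r x \<xi>)"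
      using config_values [OF \<xi> x] by (auto simp: threshold_rate_eq [OF \<xi> x])
  qed
  ultimately show ?thesis
    by (simp add: crowded_def abs_divide divide_right_mono)
qed

text \<open>
  A Lipschitz majorant of \<open>crowded\<close>. The indicator of seeing at least half ones is replaced by
  the piecewise linear function of the fraction of ones that vanishes up to \<open>p\<close> and reaches 1 at
  one half. Unlike the indicator it changes only by a multiple of \<open>1 / d\<close> when one neighbour flips.
\<close>

definition excess :: "nat \<Rightarrow> nat \<Rightarrow> real \<Rightarrow> config \<Rightarrow> real" where
  "excess d r p \<xi> =
    (\<Sum>x\<in>torus d r. max 0 ((real (neighbour_sum d r x \<xi>) / (2 * real d) - p) / (1 / 2 - p))) / real r ^ d"

lemma excess_nonneg: "0 \<le> excess d r p \<xi>"
  unfolding excess_def by (intro divide_nonneg_nonneg sum_nonneg) auto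

lemma crowded_le_excess:
  assumes "p < 1 / 2" "1 \<le> d"
  shows "crowded d r \<xi> \<le> excess d r p \<xi>"
  unfolding crowded_def excess_def
proof (intro divide_right_mono sum_mono)
  fix x
  show "(of_bool (d \<le> neighbour_sum d r x \<xi>) :: real)
      \<le> max 0 ((real (neighbour_sum d r x \<xi>) / (2 * real d) - p) / (1 / 2 - p))"
  proof (cases "d \<le> neighbour_sum d r x \<xi>")
    case True
    then have "1 / 2 \<le> real (neighbour_sum d r x \<xi>) / (2 * d)"
      using assms by (simp add: field_simps)
    then have "1 \<le> (real (neighbour_sum d r x \<xi>) / (2 * d) - p) / (1 / 2 - p)"
      using assms by (simp add: le_divide_eq)
    then show ?thesis by simp
  qed simp
qed simp

text \<open>
  Only flips from zero to one increase the excess, and these happen at crowded vertices. Such a flip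
  affects the \<open>2d\<close> neighbours, counted with multiplicity, by at most
  \<open>1 / (2d (1/2 - p))\<close> each. The total effect per crowded vertex is bounded uniformly in
  \<open>d\<close>, so the number of crowded vertices controls its own growth.
\<close>

lemma excess_drift:
  assumes \<xi>: "\<xi> \<in> configs (torus d r)" and p: "p < 1 / 2" and d: "1 \<le> d"
  shows "flip_generator (torus d r) (threshold_rate d r) (excess d r p) \<xi>
    \<le> crowded d r \<xi> / (1 / 2 - p)"
proof -
  define \<phi> where "\<phi> s = max 0 ((real s / (2 * real d) - p) / (1 / 2 - p))" for s :: nat
  \<comment> \<open>the Lipschitz constant of \<open>\<phi>\<close>\<close>
  define \<kappa> where "\<kappa> = 1 / (2 * real d) / (1 / 2 - p)"
  define b where "b y = (of_bool (d \<le> neighbour_sum d r y \<xi>) :: real)" for y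
  \<comment> \<open>the number of edges between x and y, which is 2 for neighbours when r = 2\<close>
  define w where "w x y = neighbour_sum d r x (\<lambda>z. of_bool (z = y))" for x y
  let ?V = "torus d r" and ?S = "\<lambda>x \<xi>. neighbour_sum d r x \<xi>"
  have \<kappa>: "0 \<le> \<kappa>" using p by (simp add: \<kappa>_def)
  have \<phi>_mono: "\<phi> s \<le> \<phi> s'" if "s \<le> s'" for s s'
    unfolding \<phi>_def using that p
    by (intro max.mono divide_right_mono diff_right_mono) auto
  have \<phi>_lipschitz: "\<phi> (s + k) - \<phi> s \<le> \<kappa> * real k" for s k
  proof -
    have "(real (s + k) / (2 * real d) - p) / (1 / 2 - p)
        = (real s / (2 * real d) - p) / (1 / 2 - p) + \<kappa> * real k"
      by (simp add: \<kappa>_def add_divide_distrib diff_divide_distrib)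
    moreover have "0 \<le> \<kappa> * real k" using \<kappa> by simp
    ultimately show ?thesis unfolding \<phi>_def by linarith
  qed
  have site: "threshold_rate d r y \<xi> * (\<phi> (?S x (flip y \<xi>)) - \<phi> (?S x \<xi>)) \<le> \<kappa> * (b y * real (w x y))"
    if x: "x \<in> ?V" and y: "y \<in> ?V" for x y
  proof (cases "\<xi> y = 0")
    case True
    have "?S x (flip y \<xi>) = neighbour_sum d r x (\<lambda>z. \<xi> z + of_bool (z = y))"
      using True by (intro neighbour_sum_cong_torus x) (simp add: flip_def)
    also have "\<dots> = ?S x \<xi> + w x y"
      unfolding w_def by (rule neighbour_sum_add [OF x])
    finally have "\<phi> (?S x (flip y \<xi>)) - \<phi> (?S x \<xi>) \<le> \<kappa> * real (w x y)"
      using \<phi>_lipschitz by simp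
    then have "b y * (\<phi> (?S x (flip y \<xi>)) - \<phi> (?S x \<xi>)) \<le> b y * (\<kappa> * real (w x y))"
      by (intro mult_left_mono) (auto simp: b_def)
    moreover have "threshold_rate d r y \<xi> = b y"
      using True by (simp add: threshold_rate_eq [OF \<xi> y] b_def)
    ultimately show ?thesis by (simp add: algebra_simps)
  next
    case False
    have "?S x (flip y \<xi>) \<le> ?S x \<xi>"
      using False config_values [OF \<xi> y] by (intro neighbour_sum_mono_torus x) (auto simp: flip_def)
    then have "threshold_rate d r y \<xi> * (\<phi> (?S x (flip y \<xi>)) - \<phi> (?S x \<xi>)) \<le> 0"
      using \<phi>_mono by (intro mult_nonneg_nonpos) (auto simp: threshold_rate_def)
    also have "0 \<le> \<kappa> * (b y * real (w x y))"
      using \<kappa> by (simp add: b_def)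
    finally show ?thesis .
  qed
  have "flip_generator ?V (threshold_rate d r) (excess d r p) \<xi>
      = (\<Sum>y\<in>?V. \<Sum>x\<in>?V. threshold_rate d r y \<xi> * (\<phi> (?S x (flip y \<xi>)) - \<phi> (?S x \<xi>))) / real r ^ d"
    unfolding flip_generator_def excess_def \<phi>_def
    by (simp add: sum_divide_distrib sum_distrib_left sum_subtractf diff_divide_distrib
          right_diff_distrib)
  also have "\<dots> \<le> (\<Sum>y\<in>?V. \<Sum>x\<in>?V. \<kappa> * (b y * real (w x y))) / real r ^ d"
    using site by (intro divide_right_mono sum_mono) auto
  also have "(\<Sum>y\<in>?V. \<Sum>x\<in>?V. \<kappa> * (b y * real (w x y))) = (\<Sum>y\<in>?V. b y / (1 / 2 - p))"
  proof (rule sum.cong [OF refl])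
    fix y assume y: "y \<in> ?V"
    have "(\<Sum>x\<in>?V. w x y) = 2 * d"
      unfolding w_def sum_neighbour_sum using y by (simp add: finite_torus)
    then have "(\<Sum>x\<in>?V. real (w x y)) = 2 * real d"
      by (metis of_nat_mult of_nat_numeral of_nat_sum)
    then have "(\<Sum>x\<in>?V. \<kappa> * (b y * real (w x y))) = \<kappa> * b y * (2 * real d)"
      by (simp flip: sum_distrib_left mult.assoc)
    then show "(\<Sum>x\<in>?V. \<kappa> * (b y * real (w x y))) = b y / (1 / 2 - p)"
      using d by (simp add: \<kappa>_def)
  qed
  finally show ?thesis
    by (simp add: crowded_def b_def sum_divide_distrib mult.commute)
qed

text \<open>
  The supermartingale of the proof. The square is the deviation of interest, rescaled by
  \<open>exp t\<close> so that exponential decay becomes constancy. Its expected growth has two sources: the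
  crowded vertices, which are paid for by the decreasing factor in front of the excess, and the jump
  noise of order \<open>1 / r ^ d\<close>, which is paid for by the last term. The exponent
  \<open>1 / (1/2 - p) + 1\<close> exceeds the growth rate of the excess by one, and this surplus absorbs
  the drift error.
\<close>

definition potential :: "nat \<Rightarrow> nat \<Rightarrow> real \<Rightarrow> real \<Rightarrow> real \<Rightarrow> config \<Rightarrow> real" where
  "potential d r p T t \<xi> = (exp t * ones_density d r \<xi> - p)\<^sup>2
    + 2 * exp (2 * T) * exp ((1 / (1 / 2 - p) + 1) * (T - t)) * excess d r p \<xi>
    + exp (2 * T) / real r ^ d * (T - t)"

definition potential_rate :: "nat \<Rightarrow> nat \<Rightarrow> real \<Rightarrow> real \<Rightarrow> real \<Rightarrow> config \<Rightarrow> real" where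
  "potential_rate d r p T t \<xi> = 2 * (exp t * ones_density d r \<xi> - p) * (exp t * ones_density d r \<xi>)
    - (1 / (1 / 2 - p) + 1) * (2 * exp (2 * T) * exp ((1 / (1 / 2 - p) + 1) * (T - t))) * excess d r p \<xi>
    - exp (2 * T) / real r ^ d"

lemma potential_has_derivative:
  "((\<lambda>t. potential d r p T t \<xi>) has_real_derivative potential_rate d r p T t \<xi>) (at t)"
proof -
  have "((\<lambda>t. (exp t * X - p)\<^sup>2 + A * exp (k * (T - t)) * E + B * (T - t)) has_real_derivative
      2 * (exp t * X - p) * (exp t * X) - k * (A * exp (k * (T - t))) * E - B) (at t)" for X A k E B
    by (auto intro!: derivative_eq_intros simp: algebra_simps)
  then show ?thesis
    unfolding potential_def potential_rate_def .
qed

lemma potential_ge: "t \<le> T \<Longrightarrow> (exp t * ones_density d r \<xi> - p)\<^sup>2 \<le> potential d r p T t \<xi>"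
  unfolding potential_def using excess_nonneg [of d r p \<xi>] by simp

text \<open>
  Write \<open>Y\<close> for \<open>exp t * density - p\<close>. The time derivative of \<open>Y\<^sup>2\<close> and the
  first-order part of its generator combine to \<open>2 Y exp t (L density + density)\<close>, which
  involves crowded vertices only. The second-order part is the sum of the squared jumps, at most
  \<open>r ^ d\<close> of them, each of size \<open>exp t / r ^ d\<close>.
\<close>

lemma potential_drift:
  assumes \<xi>: "\<xi> \<in> configs (torus d r)" and p: "0 \<le> p" "p < 1 / 2" and d: "1 \<le> d" and r: "1 \<le> r"
    and t: "0 \<le> t" "t \<le> T"
  shows "potential_rate d r p T t \<xi>
    + flip_generator (torus d r) (threshold_rate d r) (potential d r p T t) \<xi> \<le> 0"
proof -
  let ?V = "torus d r" and ?c = "threshold_rate d r"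
  define N where "N = real r ^ d"
  define K where "K = 1 / (1 / 2 - p)"
  define A where "A = 2 * exp (2 * T) * exp ((K + 1) * (T - t))"
  define X where "X = ones_density d r \<xi>"
  define \<Phi> where "\<Phi> = excess d r p \<xi>"
  define Y where "Y = exp t * X - p"
  define LX where "LX = flip_generator ?V ?c (ones_density d r) \<xi>"
  define L\<Phi> where "L\<Phi> = flip_generator ?V ?c (excess d r p) \<xi>"
  have N: "0 < N" using r by (simp add: N_def)
  have K: "0 < K" using p by (simp add: K_def)
  have A: "2 * exp (2 * T) \<le> A"
  proof -
    have "1 \<le> exp ((K + 1) * (T - t))" using K t by simp
    then show ?thesis by (simp add: A_def)
  qed
  have crowded: "crowded d r \<xi> \<le> \<Phi>" "0 \<le> crowded d r \<xi>"
    using crowded_le_excess [OF p(2) d]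
    by (auto simp: \<Phi>_def crowded_def intro!: divide_nonneg_nonneg sum_nonneg)
  have square: "(exp t * ones_density d r (flip x \<xi>) - p)\<^sup>2 - Y\<^sup>2
      = 2 * Y * exp t * (ones_density d r (flip x \<xi>) - X) + exp (2 * t) / N\<^sup>2" if x: "x \<in> ?V" for x
  proof -
    have "(1 - 2 * real (\<xi> x))\<^sup>2 = 1"
      using config_values [OF \<xi> x] by auto
    then have sq: "(ones_density d r (flip x \<xi>) - X)\<^sup>2 = 1 / N\<^sup>2"
      by (simp add: ones_density_flip [OF \<xi> x] X_def N_def power_divide)
    have "(exp t * ones_density d r (flip x \<xi>) - p)\<^sup>2 - Y\<^sup>2
        = 2 * Y * exp t * (ones_density d r (flip x \<xi>) - X) + (exp t)\<^sup>2 * (ones_density d r (flip x \<xi>) - X)\<^sup>2"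
      by (simp add: Y_def power2_eq_square algebra_simps)
    then show ?thesis by (simp add: sq exp_double)
  qed
  have "flip_generator ?V ?c (potential d r p T t) \<xi>
      = (\<Sum>x\<in>?V. ?c x \<xi> * ((exp t * ones_density d r (flip x \<xi>) - p)\<^sup>2 - Y\<^sup>2)
          + A * (?c x \<xi> * (excess d r p (flip x \<xi>) - \<Phi>)))"
    unfolding flip_generator_def potential_def Y_def X_def \<Phi>_def A_def K_def
    by (intro sum.cong refl) (simp add: algebra_simps)
  also have "\<dots> = (\<Sum>x\<in>?V. 2 * Y * exp t * (?c x \<xi> * (ones_density d r (flip x \<xi>) - X))
          + exp (2 * t) / N\<^sup>2 * ?c x \<xi> + A * (?c x \<xi> * (excess d r p (flip x \<xi>) - \<Phi>)))"
    by (intro sum.cong refl) (simp add: square algebra_simps)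
  also have "\<dots> = 2 * Y * exp t * LX + exp (2 * t) / N\<^sup>2 * (\<Sum>x\<in>?V. ?c x \<xi>) + A * L\<Phi>"
    unfolding LX_def L\<Phi>_def flip_generator_def X_def \<Phi>_def
    by (simp add: sum.distrib sum_distrib_left)
  finally have generator: "flip_generator ?V ?c (potential d r p T t) \<xi>
      = 2 * Y * exp t * LX + exp (2 * t) / N\<^sup>2 * (\<Sum>x\<in>?V. ?c x \<xi>) + A * L\<Phi>" .
  have drift: "2 * Y * exp t * (LX + X) \<le> 2 * exp (2 * T) * crowded d r \<xi>"
  proof -
    have "\<bar>Y\<bar> \<le> exp T"
    proof -
      have "0 \<le> exp t * X" "exp t * X \<le> exp T * 1"
        using ones_density_bounds [OF r \<xi>] t by (auto simp: X_def intro: mult_mono simp del: mult_1_right)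
      moreover have "1 \<le> exp T" using t by simp
      ultimately show ?thesis using p unfolding Y_def by linarith
    qed
    then have le: "\<bar>Y\<bar> * exp t * \<bar>LX + X\<bar> \<le> exp T * exp T * crowded d r \<xi>"
      using ones_density_drift [OF \<xi>] t by (intro mult_mono) (auto simp: LX_def X_def)
    have "Y * exp t * (LX + X) \<le> \<bar>Y\<bar> * exp t * \<bar>LX + X\<bar>"
      by (metis abs_exp_cancel abs_ge_self abs_mult)
    also note le
    also have "exp T * exp T = exp (2 * T)"
      by (simp add: mult_exp_exp)
    finally have "2 * (Y * exp t * (LX + X)) \<le> 2 * (exp (2 * T) * crowded d r \<xi>)"
      by (rule mult_left_mono) simp
    then show ?thesis by (simp only: mult.assoc)
  qed
  have noise: "exp (2 * t) / N\<^sup>2 * (\<Sum>x\<in>?V. ?c x \<xi>) \<le> exp (2 * T) / N"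
  proof -
    have "(\<Sum>x\<in>?V. ?c x \<xi>) \<le> (\<Sum>x\<in>?V. 1)"
      by (intro sum_mono) (simp add: threshold_rate_def)
    then have "(\<Sum>x\<in>?V. ?c x \<xi>) \<le> N"
      by (simp add: card_torus N_def)
    then have "exp (2 * t) / N\<^sup>2 * (\<Sum>x\<in>?V. ?c x \<xi>) \<le> exp (2 * T) / N\<^sup>2 * N"
      using t by (intro mult_mono divide_right_mono sum_nonneg) (auto simp: threshold_rate_def)
    then show ?thesis using N by (simp add: power2_eq_square)
  qed
  have "A * L\<Phi> \<le> A * (K * \<Phi>)"
  proof -
    have "L\<Phi> \<le> K * crowded d r \<xi>"
      using excess_drift [OF \<xi> p(2) d] by (simp add: L\<Phi>_def K_def)
    also have "\<dots> \<le> K * \<Phi>" using K crowded by simp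
    finally show ?thesis using A by (intro mult_left_mono) (auto intro: order_trans [OF _ A])
  qed
  moreover have "2 * exp (2 * T) * crowded d r \<xi> \<le> A * \<Phi>"
    using A crowded by (intro mult_mono) (auto intro: order_trans [OF _ A])
  moreover have "potential_rate d r p T t \<xi> = 2 * Y * exp t * X - (K + 1) * A * \<Phi> - exp (2 * T) / N"
    unfolding potential_rate_def Y_def X_def \<Phi>_def A_def K_def N_def by simp
  ultimately show ?thesis
    using drift noise unfolding generator by (simp add: algebra_simps)
qed

section \<open>The initial law\<close>

lemma set_product_law:
  assumes "finite V"
  shows "set_pmf (product_law V p) \<subseteq> configs V"
proof
  fix \<xi> assume "\<xi> \<in> set_pmf (product_law V p)"
  then have "\<xi> \<in> PiE_dflt V undefined (set_pmf \<circ> (\<lambda>_. map_pmf of_bool (bernoulli_pmf p)))"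
    unfolding product_law_def by (rule subsetD [OF set_Pi_pmf_subset' [OF assms]])
  then have inside: "x \<in> V \<Longrightarrow> \<xi> x \<in> range of_bool"
    and outside: "x \<notin> V \<Longrightarrow> \<xi> x = undefined" for x
    by (force simp: PiE_dflt_def)+
  have "\<xi> x \<in> {0, 1}" if "x \<in> V" for x
    using inside [OF that] by (auto simp: of_bool_def)
  then show "\<xi> \<in> configs V"
    using outside by (auto simp: configs_def PiE_iff extensional_def)
qed

lemma integrable_product_law:
  fixes f :: "config \<Rightarrow> real"
  assumes "finite V"
  shows "integrable (measure_pmf (product_law V p)) f"
  using finite_subset [OF set_product_law finite_configs] assms
  by (intro integrable_measure_pmf_finite) auto

lemma expectation_product_law:
  fixes f :: "config \<Rightarrow> real"
  assumes "finite V"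
  shows "measure_pmf.expectation (product_law V p) f = (\<Sum>\<xi>\<in>configs V. pmf (product_law V p) \<xi> * f \<xi>)"
  using set_product_law [OF assms] finite_configs [OF assms]
  by (subst integral_measure_pmf_real [where A = "configs V"]) (auto simp: mult.commute)

lemma expectation_product_law_mono:
  fixes f g :: "config \<Rightarrow> real"
  assumes "finite V" "\<And>\<xi>. \<xi> \<in> configs V \<Longrightarrow> f \<xi> \<le> g \<xi>"
  shows "measure_pmf.expectation (product_law V p) f \<le> measure_pmf.expectation (product_law V p) g"
  unfolding expectation_product_law [OF assms(1)]
  using assms(2) by (intro sum_mono mult_left_mono) auto

lemma expectation_product_law_prod:
  assumes V: "finite V" and "U \<subseteq> V" and p: "0 \<le> p" "p \<le> 1"
  shows "measure_pmf.expectation (product_law V p) (\<lambda>\<xi>. \<Prod>x\<in>U. real (\<xi> x)) = p ^ card U"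
proof -
  define f :: "vertex \<Rightarrow> nat \<Rightarrow> real" where "f x v = (if x \<in> U then real v else 1)" for x v
  have U: "(\<Prod>x\<in>V. if x \<in> U then g x else 1) = (\<Prod>x\<in>U. g x)" for g :: "vertex \<Rightarrow> real"
    using assms by (simp add: prod.inter_restrict [symmetric] Int_absorb1)
  have "measure_pmf.expectation (product_law V p) (\<lambda>\<xi>. \<Prod>x\<in>V. f x (\<xi> x))
      = (\<Prod>x\<in>V. measure_pmf.expectation (map_pmf of_bool (bernoulli_pmf p)) (f x))"
    unfolding product_law_def
    by (intro expectation_prod_Pi_pmf V integrable_measure_pmf_finite) (auto simp: f_def)
  moreover have "measure_pmf.expectation (map_pmf of_bool (bernoulli_pmf p)) (f x)
      = (if x \<in> U then p else 1)" for x
    using p by (simp add: f_def)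
  ultimately show ?thesis
    by (simp add: f_def U)
qed

text \<open>
  The coordinates are uncorrelated and have variance at most 1.
\<close>

lemma second_moment_product_law:
  assumes V: "finite V" and W: "W \<subseteq> V" and p: "0 \<le> p" "p \<le> 1"
  shows "measure_pmf.expectation (product_law V p) (\<lambda>\<xi>. (\<Sum>x\<in>W. real (\<xi> x) - p)\<^sup>2) \<le> card W"
proof -
  let ?E = "measure_pmf.expectation (product_law V p)"
  have fin: "finite W" using V W by (rule finite_subset [rotated])
  note [simp] = integrable_product_law [OF V]
  have mean: "?E (\<lambda>\<xi>. real (\<xi> x)) = p" if "x \<in> W" for x
    using expectation_product_law_prod [OF V _ p, of "{x}"] that W by auto
  have prod: "?E (\<lambda>\<xi>. real (\<xi> x) * real (\<xi> y)) = p\<^sup>2" if "x \<in> W" "y \<in> W" "x \<noteq> y" for x y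
    using expectation_product_law_prod [OF V _ p, of "{x, y}"] that W by (auto simp: power2_eq_square)
  have cov: "?E (\<lambda>\<xi>. (real (\<xi> x) - p) * (real (\<xi> y) - p)) \<le> of_bool (x = y)"
    if x: "x \<in> W" and y: "y \<in> W" for x y
  proof (cases "x = y")
    case True
    have "?E (\<lambda>\<xi>. (real (\<xi> x) - p) * (real (\<xi> y) - p)) \<le> ?E (\<lambda>\<xi>. 1)"
    proof (intro expectation_product_law_mono V)
      fix \<xi> assume \<xi>: "\<xi> \<in> configs V"
      have "\<xi> x = 0 \<or> \<xi> x = 1" using config_values [OF \<xi>] x W by auto
      then have "\<bar>real (\<xi> x) - p\<bar> \<le> 1" using p by auto
      then have "\<bar>real (\<xi> x) - p\<bar>\<^sup>2 \<le> 1" by (simp add: abs_square_le_1)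
      then show "(real (\<xi> x) - p) * (real (\<xi> y) - p) \<le> 1"
        using True by (simp add: power2_eq_square)
    qed
    then show ?thesis using True by simp
  next
    case False
    have "?E (\<lambda>\<xi>. (real (\<xi> x) - p) * (real (\<xi> y) - p))
        = ?E (\<lambda>\<xi>. real (\<xi> x) * real (\<xi> y) - p * real (\<xi> x) - p * real (\<xi> y) + p\<^sup>2)"
      by (simp add: algebra_simps power2_eq_square)
    also have "\<dots> = p\<^sup>2 - p * p - p * p + p\<^sup>2"
      by (simp add: mean [OF x] mean [OF y] prod [OF x y False])
    also have "\<dots> = 0"
      by (simp add: power2_eq_square)
    finally show ?thesis by simp
  qed
  have "?E (\<lambda>\<xi>. (\<Sum>x\<in>W. real (\<xi> x) - p)\<^sup>2)
      = (\<Sum>x\<in>W. \<Sum>y\<in>W. ?E (\<lambda>\<xi>. (real (\<xi> x) - p) * (real (\<xi> y) - p)))"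
    by (simp add: power2_eq_square sum_product)
  also have "\<dots> \<le> (\<Sum>x\<in>W. \<Sum>y\<in>W. of_bool (x = y))"
    by (intro sum_mono cov)
  also have "\<dots> = real (card W)"
    using fin by (simp add: of_bool_def)
  finally show ?thesis .
qed

lemma expected_ones_density_error:
  assumes r: "1 \<le> r" and p: "0 \<le> p" "p \<le> 1"
  shows "measure_pmf.expectation (product_law (torus d r) p) (\<lambda>\<xi>. (ones_density d r \<xi> - p)\<^sup>2)
    \<le> 1 / real r ^ d"
proof -
  define N where "N = real r ^ d"
  have N: "0 < N" using r by (simp add: N_def)
  have "ones_density d r \<xi> - p = (\<Sum>x\<in>torus d r. real (\<xi> x) - p) / N" for \<xi>
    using N by (simp add: ones_density_def sum_subtractf card_torus N_def field_simps)
  then have "measure_pmf.expectation (product_law (torus d r) p) (\<lambda>\<xi>. (ones_density d r \<xi> - p)\<^sup>2)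
      = measure_pmf.expectation (product_law (torus d r) p) (\<lambda>\<xi>. (\<Sum>x\<in>torus d r. real (\<xi> x) - p)\<^sup>2) / N\<^sup>2"
    by (simp add: power_divide)
  also have "\<dots> \<le> N / N\<^sup>2"
    using second_moment_product_law [OF finite_torus order_refl p, of d r]
    by (intro divide_right_mono) (auto simp: card_torus N_def)
  also have "\<dots> = 1 / N"
    using N by (simp add: power2_eq_square)
  finally show ?thesis by (simp add: N_def)
qed

lemma inj_on_shift:
  assumes "2 \<le> r" "x \<in> torus d r"
  shows "inj_on (\<lambda>i. shift r i x) {1..d}" "inj_on (\<lambda>i. unshift r i x) {1..d}"
proof -
  have coord: "(shift r i x) i \<noteq> x i" "(unshift r i x) i \<noteq> x i" if "i \<in> {1..d}" for i
    using torus_coord [OF assms(2) that] assms(1) by (auto simp: shift_def unshift_def)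
  have other: "(shift r j x) i = x i" "(unshift r j x) i = x i" if "i \<noteq> j" for i j
    using that by (auto simp: shift_def unshift_def)
  show "inj_on (\<lambda>i. shift r i x) {1..d}"
    by (rule inj_onI) (metis coord(1) other(1))
  show "inj_on (\<lambda>i. unshift r i x) {1..d}"
    by (rule inj_onI) (metis coord(2) other(2))
qed

text \<open>
  The forward neighbours of a vertex are distinct, and so are the backward ones, but for
  \<open>r = 2\<close> a vertex can be both. The two groups are therefore treated separately, with
  \<open>(A + B)\<^sup>2 \<le> 2 A\<^sup>2 + 2 B\<^sup>2\<close>.
\<close>

lemma expected_neighbour_error:
  assumes r: "2 \<le> r" and d: "1 \<le> d" and p: "0 \<le> p" "p \<le> 1" and x: "x \<in> torus d r"
  shows "measure_pmf.expectation (product_law (torus d r) p)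
      (\<lambda>\<xi>. (real (neighbour_sum d r x \<xi>) / (2 * real d) - p)\<^sup>2) \<le> 1 / real d"
proof -
  let ?V = "torus d r"
  let ?E = "measure_pmf.expectation (product_law ?V p)"
  note [simp] = integrable_product_law [OF finite_torus [of d r]]
  let ?W = "(\<lambda>i. shift r i x) ` {1..d}" and ?W' = "(\<lambda>i. unshift r i x) ` {1..d}"
  let ?A = "\<lambda>\<xi>. \<Sum>y\<in>?W. real (\<xi> y) - p" and ?B = "\<lambda>\<xi>. \<Sum>y\<in>?W'. real (\<xi> y) - p"
  have W: "?W \<subseteq> ?V" "?W' \<subseteq> ?V" "card ?W = d" "card ?W' = d"
    using x card_image [OF inj_on_shift(1) [OF r x]] card_image [OF inj_on_shift(2) [OF r x]]
    by (auto simp: shift_in_torus unshift_in_torus)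
  have "?E (\<lambda>\<xi>. (real (neighbour_sum d r x \<xi>) / (2 * real d) - p)\<^sup>2)
      \<le> ?E (\<lambda>\<xi>. ((?A \<xi>)\<^sup>2 + (?B \<xi>)\<^sup>2) / (2 * (real d)\<^sup>2))"
  proof (rule expectation_product_law_mono [OF finite_torus])
    fix \<xi>
    have "?A \<xi> = (\<Sum>i\<in>{1..d}. real (\<xi> (shift r i x)) - p)"
      "?B \<xi> = (\<Sum>i\<in>{1..d}. real (\<xi> (unshift r i x)) - p)"
      using sum.reindex [OF inj_on_shift(1) [OF r x], where g = "\<lambda>y. real (\<xi> y) - p"]
        sum.reindex [OF inj_on_shift(2) [OF r x], where g = "\<lambda>y. real (\<xi> y) - p"] by simp_all
    then have "?A \<xi> + ?B \<xi> = real (neighbour_sum d r x \<xi>) - 2 * real d * p"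
      by (simp add: neighbour_sum_eq [OF x] sum_subtractf sum.distrib)
    then have "real (neighbour_sum d r x \<xi>) / (2 * real d) - p = (?A \<xi> + ?B \<xi>) / (2 * real d)"
      using d by (simp add: field_simps)
    moreover have "((?A \<xi> + ?B \<xi>) / (2 * real d))\<^sup>2 = (?A \<xi> + ?B \<xi>)\<^sup>2 / 2 / (2 * (real d)\<^sup>2)"
      by (simp add: power_divide power_mult_distrib)
    moreover have "(?A \<xi> + ?B \<xi>)\<^sup>2 / 2 \<le> (?A \<xi>)\<^sup>2 + (?B \<xi>)\<^sup>2"
      using sum_squares_bound [of "?A \<xi>" "?B \<xi>"] by (simp add: power2_sum)
    ultimately show "(real (neighbour_sum d r x \<xi>) / (2 * real d) - p)\<^sup>2
        \<le> ((?A \<xi>)\<^sup>2 + (?B \<xi>)\<^sup>2) / (2 * (real d)\<^sup>2)"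
      by (simp only:) (intro divide_right_mono, auto)
  qed
  also have "\<dots> = (?E (\<lambda>\<xi>. (?A \<xi>)\<^sup>2) + ?E (\<lambda>\<xi>. (?B \<xi>)\<^sup>2)) / (2 * (real d)\<^sup>2)"
    by simp
  also have "\<dots> \<le> (real d + real d) / (2 * (real d)\<^sup>2)"
    using second_moment_product_law [OF finite_torus W(1) p] second_moment_product_law [OF finite_torus W(2) p] W
    by (intro divide_right_mono add_mono) auto
  also have "\<dots> = 1 / real d"
    using d by (simp add: power2_eq_square)
  finally show ?thesis .
qed

text \<open>
  The law of large numbers at a single vertex: the fraction of ones around it is close to \<open>p\<close>,
  so its positive deviation from \<open>p\<close> is small on average. The first absolute moment is bounded by the second one through
  \<open>2 \<bar>u\<bar> \<le> s u\<^sup>2 + 1 / s\<close>, where \<open>s = sqrt d\<close> balances the two terms.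
\<close>

lemma expected_excess:
  assumes r: "2 \<le> r" and d: "1 \<le> d" and p: "0 \<le> p" "p < 1 / 2"
  shows "measure_pmf.expectation (product_law (torus d r) p) (excess d r p)
    \<le> 1 / (1 / 2 - p) / sqrt (real d)"
proof -
  let ?V = "torus d r"
  let ?E = "measure_pmf.expectation (product_law ?V p)"
  note [simp] = integrable_product_law [OF finite_torus [of d r]]
  define K where "K = 1 / (1 / 2 - p)"
  have K: "0 < K" using p by (simp add: K_def)
  define u where "u x \<xi> = real (neighbour_sum d r x \<xi>) / (2 * real d) - p" for x \<xi>
  define s where "s = sqrt (real d)"
  have s: "0 < s" "real d = s * s" using d by (auto simp: s_def)
  have site: "?E (\<lambda>\<xi>. max 0 (u x \<xi> / (1 / 2 - p))) \<le> K / s" if x: "x \<in> ?V" for x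
  proof -
    have "?E (\<lambda>\<xi>. max 0 (u x \<xi> / (1 / 2 - p))) \<le> ?E (\<lambda>\<xi>. K * ((s * (u x \<xi>)\<^sup>2 + 1 / s) / 2))"
    proof (rule expectation_product_law_mono [OF finite_torus])
      fix \<xi>
      have "0 \<le> (s * \<bar>u x \<xi>\<bar> - 1)\<^sup>2 / s" using s by simp
      also have "\<dots> = s * (u x \<xi>)\<^sup>2 + 1 / s - 2 * \<bar>u x \<xi>\<bar>"
        using s(1) by (simp add: power2_eq_square field_simps)
      finally have u: "\<bar>u x \<xi>\<bar> \<le> (s * (u x \<xi>)\<^sup>2 + 1 / s) / 2" by simp
      have "max 0 (u x \<xi> / (1 / 2 - p)) \<le> K * \<bar>u x \<xi>\<bar>"
      proof -
        have "K * u x \<xi> \<le> K * \<bar>u x \<xi>\<bar>" "0 \<le> K * \<bar>u x \<xi>\<bar>"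
          using K by (auto intro: mult_left_mono)
        then show ?thesis by (simp add: K_def)
      qed
      also have "\<dots> \<le> K * ((s * (u x \<xi>)\<^sup>2 + 1 / s) / 2)"
        using u K by (intro mult_left_mono) auto
      finally show "max 0 (u x \<xi> / (1 / 2 - p)) \<le> K * ((s * (u x \<xi>)\<^sup>2 + 1 / s) / 2)" .
    qed
    also have "\<dots> = K * ((s * ?E (\<lambda>\<xi>. (u x \<xi>)\<^sup>2) + 1 / s) / 2)"
      by simp
    also have "\<dots> \<le> K * ((s * (1 / real d) + 1 / s) / 2)"
      using expected_neighbour_error [OF r d _ _ x, of p] p K s
      by (intro mult_left_mono divide_right_mono add_mono) (auto simp: u_def)
    also have "\<dots> = K / s"
      using s(1) unfolding s(2) by simp
    finally show ?thesis .
  qed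
  have "?E (excess d r p) = (\<Sum>x\<in>?V. ?E (\<lambda>\<xi>. max 0 (u x \<xi> / (1 / 2 - p)))) / real r ^ d"
    unfolding excess_def u_def by simp
  also have "\<dots> \<le> (\<Sum>x\<in>?V. K / s) / real r ^ d"
    by (intro divide_right_mono sum_mono site) auto
  also have "\<dots> = K / s"
    using r by (simp add: card_torus)
  finally show ?thesis by (simp add: K_def s_def)
qed

text \<open>
  The three summands come from the three terms of the initial potential, the expectations of
  which are at most these summands divided by \<open>sqrt d\<close>.
\<close>

definition deviation_constant :: "real \<Rightarrow> real \<Rightarrow> real" where
  "deviation_constant p T = 1
    + 2 * exp (2 * T) * exp ((1 / (1 / 2 - p) + 1) * T) * (1 / (1 / 2 - p)) + exp (2 * T) * T"

lemma expected_initial_potential: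
  assumes r: "2 \<le> r" and d: "1 \<le> d" and p: "0 \<le> p" "p < 1 / 2" and T: "0 \<le> T"
  shows "measure_pmf.expectation (product_law (torus d r) p) (potential d r p T 0)
    \<le> deviation_constant p T / sqrt (real d)"
proof -
  let ?E = "measure_pmf.expectation (product_law (torus d r) p)"
  note [simp] = integrable_product_law [OF finite_torus [of d r]]
  define K where "K = 1 / (1 / 2 - p)"
  define A where "A = 2 * exp (2 * T) * exp ((K + 1) * T)"
  have small: "1 / real r ^ d \<le> 1 / sqrt (real d)"
  proof -
    have "real d \<le> real (2 ^ d)" by (intro of_nat_mono less_imp_le less_exp)
    also have "\<dots> = 2 ^ d" by simp
    also have "\<dots> \<le> real r ^ d" using r by (intro power_mono) auto
    finally have "real d \<le> real r ^ d" .
    moreover have "sqrt (real d) \<le> real d" using d by (intro real_le_lsqrt) (auto simp: power2_eq_square)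
    ultimately have "sqrt (real d) \<le> real r ^ d" by linarith
    then show ?thesis using d by (intro frac_le) auto
  qed
  have "?E (potential d r p T 0) = ?E (\<lambda>\<xi>. (ones_density d r \<xi> - p)\<^sup>2) + A * ?E (excess d r p)
      + exp (2 * T) / real r ^ d * T"
    unfolding potential_def A_def K_def by simp
  also have "\<dots> \<le> 1 / sqrt (real d) + A * (K / sqrt (real d)) + exp (2 * T) * (1 / sqrt (real d)) * T"
  proof (intro add_mono mult_right_mono mult_left_mono T)
    show "?E (\<lambda>\<xi>. (ones_density d r \<xi> - p)\<^sup>2) \<le> 1 / sqrt (real d)"
      using expected_ones_density_error [of r p d] r p small by linarith
    show "?E (excess d r p) \<le> K / sqrt (real d)"
      using expected_excess [OF r d p] by (simp add: K_def)
    show "exp (2 * T) / real r ^ d \<le> exp (2 * T) * (1 / sqrt (real d))"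
      using mult_left_mono [OF small, of "exp (2 * T)"] by simp
  qed (simp add: A_def)
  also have "\<dots> = deviation_constant p T / sqrt (real d)"
    unfolding deviation_constant_def A_def K_def by (simp add: add_divide_distrib)
  finally show ?thesis .
qed

section \<open>The probability of a deviation\<close>

lemma flip_generator_symmetry:
  assumes "\<And>x. x \<in> V \<Longrightarrow> c x (\<sigma> \<xi>) = c x \<xi> \<and> \<sigma> (flip x \<xi>) = flip x (\<sigma> \<xi>)"
  shows "flip_generator V c (\<lambda>\<xi>. f (\<sigma> \<xi>)) \<xi> = flip_generator V c f (\<sigma> \<xi>)"
  unfolding flip_generator_def using assms by (intro sum.cong) auto

text \<open>
  A quantitative form of the limit theorem. The map \<open>\<sigma>\<close> is a symmetry of the dynamics, either
  the identity or the exchange of zeros and ones. Composing the potential with \<open>\<sigma>\<close> covers initial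
  densities on both sides of one half by one argument, without transforming the process. The function
  \<open>D\<close> is left abstract because it has to agree with the deviation only on \<open>configs\<close>.
\<close>

lemma deviation_bound:
  assumes r: "2 \<le> r" and d: "1 \<le> d" and p: "0 \<le> p" "p < 1 / 2" and T: "0 < T"
    and model: "threshold_voter_model d r q M \<eta>"
    and \<sigma>: "\<And>\<xi>. \<xi> \<in> configs (torus d r) \<Longrightarrow> \<sigma> \<xi> \<in> configs (torus d r)"
    and symmetry: "\<And>x \<xi>. x \<in> torus d r \<Longrightarrow> \<xi> \<in> configs (torus d r) \<Longrightarrow>
      threshold_rate d r x (\<sigma> \<xi>) = threshold_rate d r x \<xi> \<and> \<sigma> (flip x \<xi>) = flip x (\<sigma> \<xi>)"
    and law: "map_pmf \<sigma> (product_law (torus d r) q) = product_law (torus d r) p"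
    and D: "\<And>t \<xi>. \<xi> \<in> configs (torus d r) \<Longrightarrow> D t \<xi> = \<bar>ones_density d r (\<sigma> \<xi>) - p * exp (- t)\<bar>"
  shows "(\<lambda>\<omega>. SUP t\<in>{0..T}. D t (\<eta> t \<omega>)) \<in> borel_measurable M"
    and "0 < \<epsilon> \<Longrightarrow> measure M {\<omega> \<in> space M. \<epsilon> < \<bar>(SUP t\<in>{0..T}. D t (\<eta> t \<omega>)) - 0\<bar>}
      \<le> deviation_constant p T / sqrt (real d) / \<epsilon>\<^sup>2"
proof -
  let ?V = "torus d r"
  have process: "flip_process ?V (threshold_rate d r) M \<eta>"
    and start: "distr M (count_space UNIV) (\<eta> 0) = measure_pmf (product_law ?V q)"
    using model by (auto simp: threshold_voter_model_def)
  interpret flip_rates ?V "threshold_rate d r"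
    by (rule flip_rates_threshold)
  interpret flip_system ?V "threshold_rate d r" M \<eta>
    by unfold_locales (rule process)
  define F where "F t \<xi> = \<bar>ones_density d r (\<sigma> \<xi>) - p * exp (- t)\<bar>" for t \<xi>
  have cont: "continuous_on UNIV (\<lambda>t. F t \<xi>)" for \<xi>
    unfolding F_def by (intro continuous_intros)
  have SUP_eq: "(SUP t\<in>{0..T}. D t (\<eta> t \<omega>)) = (SUP t\<in>{0..T}. F t (\<eta> t \<omega>))"
    if "\<omega> \<in> space M" for \<omega>
    using state_in_configs [OF _ that] by (intro SUP_cong) (auto simp: D F_def)
  show "(\<lambda>\<omega>. SUP t\<in>{0..T}. D t (\<eta> t \<omega>)) \<in> borel_measurable M"
    using measurable_SUP_along_path [where F = F, OF cont T] SUP_eq by (simp cong: measurable_cong)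
  assume \<epsilon>: "0 < \<epsilon>"
  have SUP_nonneg: "0 \<le> (SUP t\<in>{0..T}. F t (\<eta> t \<omega>))" if "\<omega> \<in> space M" for \<omega>
  proof -
    have "0 \<le> F 0 (\<eta> 0 \<omega>)" by (simp add: F_def)
    also have "\<dots> \<le> (SUP t\<in>{0..T}. F t (\<eta> t \<omega>))"
      using T by (intro cSUP_upper bdd_above_along_path cont that) auto
    finally show ?thesis .
  qed
  have start_prob: "prob {\<omega> \<in> space M. \<eta> 0 \<omega> = \<xi>} = pmf (product_law ?V q) \<xi>" for \<xi>
  proof -
    have "pmf (product_law ?V q) \<xi> = measure (distr M (count_space UNIV) (\<eta> 0)) {\<xi>}"
      by (simp add: start pmf.rep_eq)
    also have "\<dots> = prob (\<eta> 0 -` {\<xi>} \<inter> space M)"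
      by (intro measure_distr measurable_state) auto
    also have "\<eta> 0 -` {\<xi>} \<inter> space M = {\<omega> \<in> space M. \<eta> 0 \<omega> = \<xi>}"
      by auto
    finally show ?thesis ..
  qed
  have "\<epsilon>\<^sup>2 * prob {\<omega> \<in> space M. \<epsilon> < (SUP t\<in>{0..T}. F t (\<eta> t \<omega>))}
      \<le> (\<Sum>\<xi>\<in>configs ?V. prob {\<omega> \<in> space M. \<eta> 0 \<omega> = \<xi>} * potential d r p T 0 (\<sigma> \<xi>))"
  proof (rule maximal_inequality [where F = F and G = "\<lambda>t \<xi>. potential d r p T t (\<sigma> \<xi>)"
        and G' = "\<lambda>t \<xi>. potential_rate d r p T t (\<sigma> \<xi>)", OF cont T])
    fix t \<xi> assume t: "0 \<le> t" "t \<le> T" and \<xi>: "\<xi> \<in> configs ?V"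
    show "0 \<le> potential d r p T t (\<sigma> \<xi>)"
      using potential_ge [OF t(2), of d r "\<sigma> \<xi>" p] zero_le_power2 order_trans by blast
    show "((\<lambda>t. potential d r p T t (\<sigma> \<xi>)) has_real_derivative potential_rate d r p T t (\<sigma> \<xi>)) (at t)"
      by (rule potential_has_derivative)
    show "potential_rate d r p T t (\<sigma> \<xi>) + flip_generator ?V (threshold_rate d r)
        (\<lambda>\<xi>. potential d r p T t (\<sigma> \<xi>)) \<xi> \<le> 0"
    proof -
      have "flip_generator ?V (threshold_rate d r) (\<lambda>\<xi>. potential d r p T t (\<sigma> \<xi>)) \<xi>
          = flip_generator ?V (threshold_rate d r) (potential d r p T t) (\<sigma> \<xi>)"
        by (rule flip_generator_symmetry) (rule symmetry [OF _ \<xi>])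
      then show ?thesis
        using potential_drift [OF \<sigma> [OF \<xi>] p d _ t] r by simp
    qed
    \<comment> \<open>F is the unscaled deviation, which is at most the rescaled one in the potential.\<close>
    assume "\<epsilon> < F t \<xi>"
    also have "F t \<xi> = \<bar>exp t * ones_density d r (\<sigma> \<xi>) - p\<bar> * exp (- t)"
    proof -
      have "ones_density d r (\<sigma> \<xi>) - p * exp (- t)
          = (exp t * ones_density d r (\<sigma> \<xi>) - p) * exp (- t)"
        by (simp add: algebra_simps exp_minus_inverse flip: exp_add)
      then show ?thesis by (simp add: F_def abs_mult)
    qed
    also have "\<dots> \<le> \<bar>exp t * ones_density d r (\<sigma> \<xi>) - p\<bar>"
      using t by (intro mult_right_le_one_le) auto
    finally have "\<epsilon>\<^sup>2 \<le> (exp t * ones_density d r (\<sigma> \<xi>) - p)\<^sup>2"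
      using \<epsilon> power_mono [of \<epsilon> "\<bar>exp t * ones_density d r (\<sigma> \<xi>) - p\<bar>" 2] by simp
    then show "\<epsilon>\<^sup>2 \<le> potential d r p T t (\<sigma> \<xi>)"
      using potential_ge [OF t(2)] by (rule order_trans)
  qed simp
  also have "\<dots> = measure_pmf.expectation (product_law ?V p) (potential d r p T 0)"
    by (simp add: start_prob law [symmetric] expectation_product_law [OF finite_torus, symmetric])
  also have "\<dots> \<le> deviation_constant p T / sqrt (real d)"
    using T by (intro expected_initial_potential r d p) auto
  finally have "prob {\<omega> \<in> space M. \<epsilon> < (SUP t\<in>{0..T}. F t (\<eta> t \<omega>))}
      \<le> deviation_constant p T / sqrt (real d) / \<epsilon>\<^sup>2"
    using \<epsilon> by (subst pos_le_divide_eq) (simp_all add: mult.commute)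
  moreover have "{\<omega> \<in> space M. \<epsilon> < \<bar>(SUP t\<in>{0..T}. D t (\<eta> t \<omega>)) - 0\<bar>}
      = {\<omega> \<in> space M. \<epsilon> < (SUP t\<in>{0..T}. F t (\<eta> t \<omega>))}"
    using SUP_nonneg SUP_eq by (intro Collect_cong) auto
  ultimately show "prob {\<omega> \<in> space M. \<epsilon> < \<bar>(SUP t\<in>{0..T}. D t (\<eta> t \<omega>)) - 0\<bar>}
      \<le> deviation_constant p T / sqrt (real d) / \<epsilon>\<^sup>2"
    by simp
qed

section \<open>Exchanging zeros and ones\<close>

definition complement :: "vertex set \<Rightarrow> config \<Rightarrow> config" where
  "complement V \<xi> = (\<lambda>x. if x \<in> V then 1 - \<xi> x else undefined)"

lemma complement_in_configs: "complement V \<xi> \<in> configs V"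
  if "\<xi> \<in> configs V"
  using that by (auto simp: complement_def configs_def PiE_iff extensional_def)

lemma complement_flip: "x \<in> V \<Longrightarrow> complement V (flip x \<xi>) = flip x (complement V \<xi>)"
  by (auto simp: complement_def flip_def)

lemma threshold_rate_complement:
  assumes \<xi>: "\<xi> \<in> configs (torus d r)" and x: "x \<in> torus d r"
  shows "threshold_rate d r x (complement (torus d r) \<xi>) = threshold_rate d r x \<xi>"
proof -
  have "neighbour_sum d r x (\<lambda>y. if complement (torus d r) \<xi> y \<noteq> complement (torus d r) \<xi> x then 1 else 0)
      = neighbour_sum d r x (\<lambda>y. if \<xi> y \<noteq> \<xi> x then 1 else 0)"
  proof (rule neighbour_sum_cong_torus [OF x])
    fix y assume "y \<in> torus d r"
    then show "(if complement (torus d r) \<xi> y \<noteq> complement (torus d r) \<xi> x then 1 else 0)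
        = (if \<xi> y \<noteq> \<xi> x then 1 else (0 :: nat))"
      using config_values [OF \<xi>, of y] config_values [OF \<xi> x] x by (auto simp: complement_def)
  qed
  then show ?thesis by (simp add: threshold_rate_def)
qed

lemma ones_density_complement:
  assumes \<xi>: "\<xi> \<in> configs (torus d r)" and r: "1 \<le> r"
  shows "ones_density d r (complement (torus d r) \<xi>) = 1 - ones_density d r \<xi>"
proof -
  have "(\<Sum>x\<in>torus d r. real (complement (torus d r) \<xi> x)) = (\<Sum>x\<in>torus d r. 1 - real (\<xi> x))"
    using config_values [OF \<xi>] by (intro sum.cong) (force simp: complement_def)+
  then show ?thesis
    using r by (simp add: ones_density_def sum_subtractf card_torus diff_divide_distrib)
qed

text \<open>
  Applying \<open>v \<mapsto> 1 - v\<close> to all coordinates also changes the default value outside \<open>V\<close>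
  from \<open>undefined\<close> to \<open>1 - undefined\<close>, so it is reset afterwards.
\<close>

lemma product_law_complement:
  assumes V: "finite V" and p: "0 \<le> p" "p \<le> 1"
  shows "map_pmf (complement V) (product_law V p) = product_law V (1 - p)"
proof -
  let ?B = "\<lambda>p. map_pmf of_bool (bernoulli_pmf p) :: nat pmf"
  have "bernoulli_pmf (1 - p) = map_pmf Not (bernoulli_pmf p)"
  proof (rule pmf_eqI)
    fix b
    have "pmf (map_pmf Not (bernoulli_pmf p)) (\<not> \<not> b) = pmf (bernoulli_pmf p) (\<not> b)"
      by (rule pmf_map_inj') (auto intro: injI)
    then show "pmf (bernoulli_pmf (1 - p)) b = pmf (map_pmf Not (bernoulli_pmf p)) b"
      using p by (cases b) auto
  qed
  moreover have "of_bool \<circ> Not = (\<lambda>v :: nat. 1 - v) \<circ> of_bool"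
    by auto
  ultimately have B: "?B (1 - p) = map_pmf (\<lambda>v. 1 - v) (?B p)"
    by (simp only: pmf.map_comp)
  have "product_law V (1 - p)
      = map_pmf (\<lambda>\<xi> x. if x \<in> V then \<xi> x else undefined) (Pi_pmf V (1 - undefined) (\<lambda>_. ?B (1 - p)))"
    unfolding product_law_def by (rule Pi_pmf_default_swap [OF V, symmetric])
  also have "Pi_pmf V (1 - undefined) (\<lambda>_. ?B (1 - p)) = map_pmf (\<lambda>\<xi>. (\<lambda>v. 1 - v) \<circ> \<xi>) (product_law V p)"
    unfolding B product_law_def by (rule Pi_pmf_map [OF V refl])
  finally show ?thesis
    by (simp add: pmf.map_comp o_def complement_def [abs_def] del: One_nat_def)
qed

section \<open>The limit theorem\<close>

lemma tendsto_in_prob_sqrtI: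
  assumes "\<And>n. 1 \<le> n \<Longrightarrow> X n \<in> borel_measurable (M n)"
    and "\<And>n \<epsilon>. 1 \<le> n \<Longrightarrow> 0 < \<epsilon> \<Longrightarrow>
      measure (M n) {\<omega> \<in> space (M n). \<epsilon> < \<bar>X n \<omega> - l\<bar>} \<le> C / sqrt (real n) / \<epsilon>\<^sup>2"
  shows "tendsto_in_prob M X l"
  unfolding tendsto_in_prob_def
proof (intro conjI allI impI)
  show "\<forall>\<^sub>F n in sequentially. X n \<in> borel_measurable (M n)"
    using assms(1) by (auto simp: eventually_sequentially)
  fix \<epsilon> :: real assume \<epsilon>: "0 < \<epsilon>"
  have "(\<lambda>n. 1 / sqrt (real n)) \<longlonglongrightarrow> 0"
    by (intro tendsto_divide_0 [OF tendsto_const] filterlim_at_top_imp_at_infinity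
        filterlim_compose [OF sqrt_at_top filterlim_real_sequentially])
  then have "(\<lambda>n. C / \<epsilon>\<^sup>2 * (1 / sqrt (real n))) \<longlonglongrightarrow> C / \<epsilon>\<^sup>2 * 0"
    by (intro tendsto_mult_left)
  then have "(\<lambda>n. C / sqrt (real n) / \<epsilon>\<^sup>2) \<longlonglongrightarrow> 0"
    by (simp add: mult.commute)
  then show "(\<lambda>n. measure (M n) {\<omega> \<in> space (M n). \<epsilon> < \<bar>X n \<omega> - l\<bar>}) \<longlonglongrightarrow> 0"
  proof (rule Lim_null_comparison [rotated])
    show "\<forall>\<^sub>F n in sequentially. norm (measure (M n) {\<omega> \<in> space (M n). \<epsilon> < \<bar>X n \<omega> - l\<bar>})
        \<le> C / sqrt (real n) / \<epsilon>\<^sup>2"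
      using assms(2) \<epsilon> by (auto simp: eventually_sequentially)
  qed
qed

theorem theorem2p1:
  fixes r :: nat and p T :: real
    and M :: "nat \<Rightarrow> 'w measure" and \<eta> :: "nat \<Rightarrow> real \<Rightarrow> 'w \<Rightarrow> config"
  assumes "r \<ge> 2" and "p \<in> {0..1}" and "T > 0"
    and "\<And>d. d \<ge> 1 \<Longrightarrow> threshold_voter_model d r p (M d) (\<eta> d)"
  shows "(p \<in> {0..<1/2} \<longrightarrow>
            tendsto_in_prob M
              (\<lambda>d \<omega>. SUP t\<in>{0..T}.
                 \<bar>real (card (ones d r (\<eta> d t \<omega>))) / real r ^ d - p * exp (- t)\<bar>) 0) \<and>
         (p \<in> {1/2<..1} \<longrightarrow>
            tendsto_in_prob M
              (\<lambda>d \<omega>. SUP t\<in>{0..T}.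
                 \<bar>real (card (ones d r (\<eta> d t \<omega>))) / real r ^ d - 1 + (1 - p) * exp (- t)\<bar>) 0)"
proof (intro conjI impI)
  assume p: "p \<in> {0..<1/2}"
  let ?D = "\<lambda>d t \<xi>. \<bar>real (card (ones d r \<xi>)) / real r ^ d - p * exp (- t)\<bar>"
  have D: "?D d t \<xi> = \<bar>ones_density d r \<xi> - p * exp (- t)\<bar>"
    if "\<xi> \<in> configs (torus d r)" for d t \<xi>
    by (simp add: ones_density_eq_card_ones [OF that])
  have bound: "(\<lambda>\<omega>. SUP t\<in>{0..T}. ?D d t (\<eta> d t \<omega>)) \<in> borel_measurable (M d)"
      "0 < \<epsilon> \<Longrightarrow> measure (M d) {\<omega> \<in> space (M d). \<epsilon> < \<bar>(SUP t\<in>{0..T}. ?D d t (\<eta> d t \<omega>)) - 0\<bar>}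
        \<le> deviation_constant p T / sqrt (real d) / \<epsilon>\<^sup>2"
    if d: "1 \<le> d" for d \<epsilon>
    using p by (intro deviation_bound [where \<sigma> = "\<lambda>\<xi>. \<xi>" and p = p and D = "?D d", OF assms(1) d _ _ assms(3) assms(4) [OF d]];
      simp add: D)+
  show "tendsto_in_prob M (\<lambda>d \<omega>. SUP t\<in>{0..T}. ?D d t (\<eta> d t \<omega>)) 0"
    by (rule tendsto_in_prob_sqrtI [OF bound])
next
  assume p: "p \<in> {1/2<..1}"
  let ?D = "\<lambda>d t \<xi>. \<bar>real (card (ones d r \<xi>)) / real r ^ d - 1 + (1 - p) * exp (- t)\<bar>"
  have D: "?D d t \<xi> = \<bar>ones_density d r (complement (torus d r) \<xi>) - (1 - p) * exp (- t)\<bar>"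
    if "\<xi> \<in> configs (torus d r)" for d t \<xi>
    using assms(1) unfolding ones_density_eq_card_ones [OF that]
    by (subst ones_density_complement [OF that]) auto
  have bound: "(\<lambda>\<omega>. SUP t\<in>{0..T}. ?D d t (\<eta> d t \<omega>)) \<in> borel_measurable (M d)"
      "0 < \<epsilon> \<Longrightarrow> measure (M d) {\<omega> \<in> space (M d). \<epsilon> < \<bar>(SUP t\<in>{0..T}. ?D d t (\<eta> d t \<omega>)) - 0\<bar>}
        \<le> deviation_constant (1 - p) T / sqrt (real d) / \<epsilon>\<^sup>2"
    if d: "1 \<le> d" for d \<epsilon>
  proof -
    have law: "map_pmf (complement (torus d r)) (product_law (torus d r) p) = product_law (torus d r) (1 - p)"
      using p by (intro product_law_complement finite_torus) auto
    have symmetry: "threshold_rate d r x (complement (torus d r) \<xi>) = threshold_rate d r x \<xi> \<and>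
        complement (torus d r) (flip x \<xi>) = flip x (complement (torus d r) \<xi>)"
      if "x \<in> torus d r" "\<xi> \<in> configs (torus d r)" for x \<xi>
      using that by (simp add: threshold_rate_complement complement_flip)
    have q: "0 \<le> 1 - p" "1 - p < 1 / 2" using p by auto
    note * = deviation_bound [where \<sigma> = "complement (torus d r)" and D = "?D d",
        OF assms(1) d q assms(3) assms(4) [OF d] complement_in_configs symmetry law D]
    show "(\<lambda>\<omega>. SUP t\<in>{0..T}. ?D d t (\<eta> d t \<omega>)) \<in> borel_measurable (M d)"
      by (rule *(1))
    show "measure (M d) {\<omega> \<in> space (M d). \<epsilon> < \<bar>(SUP t\<in>{0..T}. ?D d t (\<eta> d t \<omega>)) - 0\<bar>}
        \<le> deviation_constant (1 - p) T / sqrt (real d) / \<epsilon>\<^sup>2" if "0 < \<epsilon>"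
      using that by (intro *(2))
  qed
  show "tendsto_in_prob M (\<lambda>d \<omega>. SUP t\<in>{0..T}. ?D d t (\<eta> d t \<omega>)) 0"
    by (rule tendsto_in_prob_sqrtI [OF bound])
qed

end
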